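(* Let $S\subset \mathrm{Sl}(n,\mathbb{H})$ be a subsemigroup with nonempty interior in $\mathrm{Sl}(n,\mathbb{H})$, and suppose that $\mathrm{Sl}(2,\mathbb{H})_{r,s}\subset S$ for some pair of indices $(r,s)$ with $1\leq r<s\leq n$. Then $S=\mathrm{Sl}(n,\mathbb{H})$.
   Context: $\mathbb{H}$ denotes the real quaternions. $\mathrm{Sl}(n,\mathbb{H})$ is the Lie group of $n\times n$ quaternionic matrices $g$ with $|\det g|=1$ (equivalently, $g$ is invertible and the real-linear map it induces on $\mathbb{H}^n\cong\mathbb{R}^{4n}$ has determinant $1$). Its Lie algebra $\mathfrak{sl}(n,\mathbb{H})$ consists of the $n\times n$ quaternionic matrices whose trace has zero real part. A subsemigroup is a subset closed under multiplication. For indices $1\le r<s\le n$, $\mathfrak{sl}(2,\mathbb{H})_{r,s}$ is the Lie subalgebra of matrices in $\mathfrak{sl}(n,\mathbb{H})$ having nonzero entries only at positions $(a,b)$ with $a,b\in\{r,s\}$, and $\mathrm{Sl}(2,\mathbb{H})_{r,s}=\langle \exp \mathfrak{sl}(2,\mathbb{H})_{r,s}\rangle$ is the subgroup of $\mathrm{Sl}(n,\mathbb{H})$ generated by its exponentials; it is isomorphic to $\mathrm{Sl}(2,\mathbb{H})$. *)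

theory Defs
  imports "HOL-Analysis.Analysis" "HOL-Algebra.Generated_Groups"
begin

section \<open>Real quaternions\<close>

datatype quat = Quat (qRe: real) (qI: real) (qJ: real) (qK: real)

lemma quat_eqI: "qRe x = qRe y \<Longrightarrow> qI x = qI y \<Longrightarrow> qJ x = qJ y \<Longrightarrow> qK x = qK y \<Longrightarrow> x = y"
  by (rule quat.expand) simp

lemma quat_eq_iff: "x = y \<longleftrightarrow> qRe x = qRe y \<and> qI x = qI y \<and> qJ x = qJ y \<and> qK x = qK y"
  by (auto intro: quat_eqI)

instantiation quat :: ab_group_add
begin

definition zero_quat :: quat where "0 = Quat 0 0 0 0"

definition plus_quat :: "quat \<Rightarrow> quat \<Rightarrow> quat"
  where "x + y = Quat (qRe x + qRe y) (qI x + qI y) (qJ x + qJ y) (qK x + qK y)"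

definition uminus_quat :: "quat \<Rightarrow> quat"
  where "- x = Quat (- qRe x) (- qI x) (- qJ x) (- qK x)"

definition minus_quat :: "quat \<Rightarrow> quat \<Rightarrow> quat"
  where "x - y = Quat (qRe x - qRe y) (qI x - qI y) (qJ x - qJ y) (qK x - qK y)"

instance
  by standard (simp_all add: quat_eq_iff zero_quat_def plus_quat_def uminus_quat_def minus_quat_def)

end

lemma quat_zero_sel [simp]: "qRe 0 = 0" "qI 0 = 0" "qJ 0 = 0" "qK 0 = 0"
  by (simp_all add: zero_quat_def)

lemma quat_plus_sel [simp]:
  "qRe (x + y) = qRe x + qRe y" "qI (x + y) = qI x + qI y"
  "qJ (x + y) = qJ x + qJ y" "qK (x + y) = qK x + qK y"
  by (simp_all add: plus_quat_def)

lemma quat_uminus_sel [simp]: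
  "qRe (- x) = - qRe x" "qI (- x) = - qI x" "qJ (- x) = - qJ x" "qK (- x) = - qK x"
  by (simp_all add: uminus_quat_def)

lemma quat_minus_sel [simp]:
  "qRe (x - y) = qRe x - qRe y" "qI (x - y) = qI x - qI y"
  "qJ (x - y) = qJ x - qJ y" "qK (x - y) = qK x - qK y"
  by (simp_all add: minus_quat_def)

instantiation quat :: ring_1
begin

definition one_quat :: quat where "1 = Quat 1 0 0 0"

definition times_quat :: "quat \<Rightarrow> quat \<Rightarrow> quat" where
  "x * y = Quat
     (qRe x * qRe y - qI x * qI y - qJ x * qJ y - qK x * qK y)
     (qRe x * qI y + qI x * qRe y + qJ x * qK y - qK x * qJ y)
     (qRe x * qJ y - qI x * qK y + qJ x * qRe y + qK x * qI y)
     (qRe x * qK y + qI x * qJ y - qJ x * qI y + qK x * qRe y)"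

instance
  by standard (simp_all add: quat_eq_iff one_quat_def times_quat_def algebra_simps)

end

lemma quat_one_sel [simp]: "qRe 1 = 1" "qI 1 = 0" "qJ 1 = 0" "qK 1 = 0"
  by (simp_all add: one_quat_def)

lemma quat_times_sel [simp]:
  "qRe (x * y) = qRe x * qRe y - qI x * qI y - qJ x * qJ y - qK x * qK y"
  "qI (x * y) = qRe x * qI y + qI x * qRe y + qJ x * qK y - qK x * qJ y"
  "qJ (x * y) = qRe x * qJ y - qI x * qK y + qJ x * qRe y + qK x * qI y"
  "qK (x * y) = qRe x * qK y + qI x * qJ y - qJ x * qI y + qK x * qRe y"
  by (simp_all add: times_quat_def)

instantiation quat :: real_algebra_1
begin

definition scaleR_quat :: "real \<Rightarrow> quat \<Rightarrow> quat"
  where "c *\<^sub>R x = Quat (c * qRe x) (c * qI x) (c * qJ x) (c * qK x)"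

instance
  by standard (simp_all add: quat_eq_iff scaleR_quat_def algebra_simps)

end

lemma quat_scaleR_sel [simp]:
  "qRe (c *\<^sub>R x) = c * qRe x" "qI (c *\<^sub>R x) = c * qI x"
  "qJ (c *\<^sub>R x) = c * qJ x" "qK (c *\<^sub>R x) = c * qK x"
  by (simp_all add: scaleR_quat_def)

instantiation quat :: real_inner
begin

definition inner_quat :: "quat \<Rightarrow> quat \<Rightarrow> real"
  where "x \<bullet> y = qRe x * qRe y + qI x * qI y + qJ x * qJ y + qK x * qK y"

definition norm_quat :: "quat \<Rightarrow> real"
  where "norm x = sqrt (x \<bullet> x)" for x :: quat

definition sgn_quat :: "quat \<Rightarrow> quat"
  where "sgn x = x /\<^sub>R norm x" for x :: quat

definition dist_quat :: "quat \<Rightarrow> quat \<Rightarrow> real"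
  where "dist x y = norm (x - y)" for x y :: quat

definition uniformity_quat :: "(quat \<times> quat) filter"
  where "uniformity = (INF e\<in>{0 <..}. principal {(x, y :: quat). dist x y < e})"

definition open_quat :: "quat set \<Rightarrow> bool"
  where "open U \<longleftrightarrow> (\<forall>x\<in>U. eventually (\<lambda>(x', y). x' = x \<longrightarrow> y \<in> U) uniformity)"
  for U :: "quat set"

instance
proof
  fix x y z :: quat and r :: real and U :: "quat set"
  show "(x \<bullet> x = 0) = (x = 0)"
    by (auto simp: inner_quat_def quat_eq_iff add_nonneg_eq_0_iff)
qed (simp_all add: inner_quat_def norm_quat_def sgn_quat_def dist_quat_def uniformity_quat_def
       open_quat_def algebra_simps)

end

instantiation quat :: real_normed_div_algebra
begin

definition inverse_quat :: "quat \<Rightarrow> quat"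
  where "inverse x = Quat (qRe x) (- qI x) (- qJ x) (- qK x) /\<^sub>R (norm x)\<^sup>2" for x :: quat

definition divide_quat :: "quat \<Rightarrow> quat \<Rightarrow> quat"
  where "x div y = x * inverse y" for x y :: quat

instance
proof
  fix x y :: quat
  show "norm (x * y) = norm x * norm y"
    unfolding norm_quat_def real_sqrt_mult[symmetric] inner_quat_def quat_times_sel
    by (rule arg_cong[where f = sqrt]) algebra
  show "x div y = x * inverse y"
    by (simp add: divide_quat_def)
  show "inverse (0 :: quat) = 0"
    by (simp add: inverse_quat_def)
  assume "x \<noteq> 0"
  then have nz: "(norm x)\<^sup>2 \<noteq> 0" by simp
  have n: "(norm x)\<^sup>2 = qRe x * qRe x + qI x * qI x + qJ x * qJ x + qK x * qK x"
    by (simp add: norm_quat_def inner_quat_def)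
  define y where "y = Quat (qRe x) (- qI x) (- qJ x) (- qK x)"
  have i: "inverse x = y /\<^sub>R (norm x)\<^sup>2" by (simp only: inverse_quat_def y_def)
  have "y * x = (norm x)\<^sup>2 *\<^sub>R 1" "x * y = (norm x)\<^sup>2 *\<^sub>R 1"
    by (simp_all add: quat_eq_iff n y_def)
  then show "inverse x * x = 1" "x * inverse x = 1" using nz by (simp_all add: i)
qed

end

instantiation quat :: euclidean_space
begin

definition Basis_quat :: "quat set"
  where "Basis = {Quat 1 0 0 0, Quat 0 1 0 0, Quat 0 0 1 0, Quat 0 0 0 1}"

instance
  by standard (auto simp: Basis_quat_def inner_quat_def intro: quat_eqI)

end


section \<open>The group \<open>Sl(n, \<bbbH>)\<close>\<close>

text \<open>The identification of \<open>\<bbbH>\<^sup>n\<close> with \<open>\<real>\<^sup>4\<^sup>n\<close>, through the real basis \<open>1, i, j, k\<close> in each coordinate.\<close>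

definition real_coords :: "quat ^ 'n \<Rightarrow> real ^ ('n \<times> 4)" where
  "real_coords v =
     (\<chi> p. (vector [qRe (v $ fst p), qI (v $ fst p), qJ (v $ fst p), qK (v $ fst p)] :: real ^ 4)
            $ snd p)"

definition quat_coords :: "real ^ ('n \<times> 4) \<Rightarrow> quat ^ 'n" where
  "quat_coords w = (\<chi> i. Quat (w $ (i, 1)) (w $ (i, 2)) (w $ (i, 3)) (w $ (i, 4)))"

lemma vector_4_nth [simp]:
  "(vector [w, x, y, z] :: 'a::zero ^ 4) $ 1 = w" "(vector [w, x, y, z] :: 'a ^ 4) $ 2 = x"
  "(vector [w, x, y, z] :: 'a ^ 4) $ 3 = y" "(vector [w, x, y, z] :: 'a ^ 4) $ 4 = z"
  by (simp_all add: vector_def)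

lemma quat_coords_real_coords [simp]: "quat_coords (real_coords v) = v"
  by (simp add: real_coords_def quat_coords_def vec_eq_iff)

lemma real_coords_quat_coords [simp]: "real_coords (quat_coords w) = w"
proof -
  have "real_coords (quat_coords w) $ (i, c) = w $ (i, c)" for i c
    using exhaust_4[of c] by (auto simp: real_coords_def quat_coords_def)
  then show ?thesis by (simp add: vec_eq_iff)
qed

text \<open>The determinant of the real-linear endomorphism \<open>x \<mapsto> g x\<close> of \<open>\<bbbH>\<^sup>n\<close>; it is the fourth power
  of the absolute value of the quaternionic (Dieudonne) determinant of \<open>g\<close>.\<close>

definition real_det :: "quat ^ 'n ^ 'n \<Rightarrow> real" where
  "real_det g = det (matrix (\<lambda>w. real_coords (g *v quat_coords w)))"

definition SL :: "(quat ^ 'n ^ 'n) monoid" where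
  "SL = \<lparr>carrier = {g. invertible g \<and> real_det g = 1}, mult = (**), one = mat 1\<rparr>"

lemma linear_real_coords_mult: "linear (\<lambda>w. real_coords (g *v quat_coords w))"
  for g :: "quat ^ 'n ^ 'n"
proof -
  have a: "linear (quat_coords :: _ \<Rightarrow> quat ^ 'n)"
    by (rule linearI) (simp_all add: quat_coords_def vec_eq_iff quat_eq_iff)
  have b: "linear (\<lambda>v :: quat ^ 'n. g *v v)"
    by (rule linearI)
      (simp_all add: matrix_vector_mult_def vec_eq_iff distrib_left sum.distrib scaleR_sum_right)
  have "linear (real_coords :: quat ^ 'n \<Rightarrow> _)"
  proof (rule linearI)
    fix x y :: "quat ^ 'n" and r :: real
    have "real_coords (x + y) $ (i, c) = (real_coords x + real_coords y) $ (i, c)" for i c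
      using exhaust_4[of c] by (auto simp: real_coords_def)
    then show "real_coords (x + y) = real_coords x + real_coords y" by (simp add: vec_eq_iff)
    have "real_coords (r *\<^sub>R x) $ (i, c) = (r *\<^sub>R real_coords x) $ (i, c)" for i c
      using exhaust_4[of c] by (auto simp: real_coords_def)
    then show "real_coords (r *\<^sub>R x) = r *\<^sub>R real_coords x" by (simp add: vec_eq_iff)
  qed
  from linear_compose[OF linear_compose[OF a b] this] show ?thesis by (simp add: o_def)
qed

lemma real_det_mult: "real_det (g ** h) = real_det g * real_det h"
  for g h :: "quat ^ 'n ^ 'n"
proof -
  have "(\<lambda>w. real_coords (g ** h *v quat_coords w))
      = (\<lambda>w. real_coords (g *v quat_coords w)) \<circ> (\<lambda>w. real_coords (h *v quat_coords w))"
    by (simp add: fun_eq_iff matrix_vector_mul_assoc)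
  then show ?thesis
    by (simp add: real_det_def matrix_compose linear_real_coords_mult det_mul)
qed

lemma real_det_one [simp]: "real_det (mat 1) = 1"
  using matrix_id by (simp add: real_det_def id_def)

lemma group_SL: "group (SL :: (quat ^ 'n ^ 'n) monoid)"
proof (rule groupI)
  fix g :: "quat ^ 'n ^ 'n" assume g: "g \<in> carrier SL"
  then obtain h where h: "g ** h = mat 1" "h ** g = mat 1"
    by (auto simp: SL_def invertible_def)
  have "real_det h * real_det g = 1" by (simp add: real_det_mult[symmetric] h)
  with g h have "h \<in> carrier SL" by (auto simp: SL_def invertible_def)
  with h show "\<exists>h\<in>carrier SL. h \<otimes>\<^bsub>SL\<^esub> g = \<one>\<^bsub>SL\<^esub>" by (auto simp: SL_def)
next
  show "\<one>\<^bsub>SL\<^esub> \<in> carrier (SL :: (quat ^ 'n ^ 'n) monoid)"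
    by (auto simp: SL_def invertible_def intro!: exI[of _ "mat 1"])
qed (auto simp: SL_def real_det_mult matrix_mul_assoc invertible_mult)


section \<open>Lie algebra, exponential, and the subgroups \<open>Sl(2, \<bbbH>)\<^sub>r\<^sub>,\<^sub>s\<close>\<close>

definition sl :: "(quat ^ 'n ^ 'n) set" where
  "sl = {A. qRe (trace A) = 0}"

definition sl2_at :: "'n \<Rightarrow> 'n \<Rightarrow> (quat ^ 'n ^ 'n) set" where
  "sl2_at r s = {A \<in> sl. \<forall>a b. A $ a $ b \<noteq> 0 \<longrightarrow> a \<in> {r, s} \<and> b \<in> {r, s}}"

text \<open>The product and powers of the type \<^typ>\<open>'a ^ 'n\<close> are componentwise, so \<^const>\<open>exp\<close> and
  \<^const>\<open>power\<close> are not the matrix ones.\<close>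

primrec mat_pow :: "quat ^ 'n ^ 'n \<Rightarrow> nat \<Rightarrow> quat ^ 'n ^ 'n" where
  "mat_pow A 0 = mat 1"
| "mat_pow A (Suc k) = A ** mat_pow A k"

definition mat_exp :: "quat ^ 'n ^ 'n \<Rightarrow> quat ^ 'n ^ 'n" where
  "mat_exp A = (\<Sum>k. mat_pow A k /\<^sub>R fact k)"

lemma norm_mat_mult_le: "norm (A ** B) \<le> norm A * norm B" for A B :: "quat ^ 'n ^ 'n"
proof -
  define c where "c = (\<lambda>j. L2_set (\<lambda>k. norm (B $ k $ j)) UNIV)"
  have *: "norm ((A ** B) $ i $ j) \<le> norm (A $ i) * c j" for i j
  proof -
    have "norm ((A ** B) $ i $ j) \<le> (\<Sum>k\<in>UNIV. norm (A $ i $ k) * norm (B $ k $ j))"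
      unfolding matrix_matrix_mult_def by (simp add: sum_norm_le norm_mult)
    also have "\<dots> \<le> norm (A $ i) * c j"
      using L2_set_mult_ineq[of "\<lambda>k. norm (A $ i $ k)" "\<lambda>k. norm (B $ k $ j)" UNIV]
      by (simp add: norm_vec_def c_def)
    finally show ?thesis .
  qed
  have nB: "(norm B)\<^sup>2 = (\<Sum>j\<in>UNIV. (c j)\<^sup>2)"
    unfolding norm_vec_def c_def L2_set_def
    by (simp add: sum_nonneg) (rule sum.swap)
  have row: "(norm M)\<^sup>2 = (\<Sum>i\<in>UNIV. (norm (M $ i))\<^sup>2)"
    for M :: "'b::real_normed_vector ^ 'n"
    by (simp add: norm_vec_def L2_set_def sum_nonneg)
  have "(norm (A ** B))\<^sup>2 = (\<Sum>i\<in>UNIV. \<Sum>j\<in>UNIV. (norm ((A ** B) $ i $ j))\<^sup>2)"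
    by (simp add: row)
  also have "\<dots> \<le> (\<Sum>i\<in>UNIV. \<Sum>j\<in>UNIV. (norm (A $ i) * c j)\<^sup>2)"
    by (intro sum_mono power_mono * norm_ge_zero)
  also have "\<dots> = (norm A * norm B)\<^sup>2"
    by (simp add: power_mult_distrib nB row[of A] sum_product)
  finally show ?thesis by (rule power2_le_imp_le) simp
qed

lemma summable_mat_exp: "summable (\<lambda>k. mat_pow A k /\<^sub>R fact k)"
proof (rule summable_norm_cancel, rule summable_comparison_test')
  have le: "norm (mat_pow A k) \<le> norm A ^ k * norm (mat 1 :: quat ^ 'a ^ 'a)" for k
  proof (induction k)
    case (Suc k)
    have "norm (mat_pow A (Suc k)) \<le> norm A * norm (mat_pow A k)"
      by (simp add: norm_mat_mult_le)
    also have "\<dots> \<le> norm A * (norm A ^ k * norm (mat 1 :: quat ^ 'a ^ 'a))"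
      by (intro mult_left_mono Suc) simp
    finally show ?case by (simp add: mult.assoc)
  qed simp
  show "norm (norm (mat_pow A k /\<^sub>R fact k))
      \<le> norm A ^ k /\<^sub>R fact k * norm (mat 1 :: quat ^ 'a ^ 'a)" if "k \<ge> 0" for k
    using mult_left_mono[OF le[of k], of "inverse (fact k)"] by (simp add: mult.assoc)
  show "summable (\<lambda>k. norm A ^ k /\<^sub>R fact k * norm (mat 1 :: quat ^ 'a ^ 'a))"
    by (intro summable_mult2 summable_exp_generic)
qed

definition SL2_at :: "'n \<Rightarrow> 'n \<Rightarrow> (quat ^ 'n ^ 'n) set" where
  "SL2_at r s = generate SL (mat_exp ` sl2_at r s)"

definition subsemigroup :: "'a set \<Rightarrow> ('a, 'b) monoid_scheme \<Rightarrow> bool" where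
  "subsemigroup S G \<longleftrightarrow> S \<subseteq> carrier G \<and> (\<forall>x\<in>S. \<forall>y\<in>S. x \<otimes>\<^bsub>G\<^esub> y \<in> S)"

end

theory Submission
  imports Defs "HOL-Computational_Algebra.Fundamental_Theorem_Algebra"
begin

text \<open>The interior of \<open>S\<close> contains an element \<open>p\<close> with eigenvalues of distinct absolute values, and after
  a perturbation its eigenbasis is in general position with respect to the root subgroup \<open>1 + c E\<^sub>s\<^sub>r\<close>.
  In this basis, ordered by decreasing absolute value, a suitable \<open>c\<close> makes \<open>h = 1 + c E\<^sub>s\<^sub>r\<close> lie in the
  Bruhat cell of any given adjacent transposition: \<open>L h u\<close> is monomial with \<open>L\<close> lower and \<open>u\<close> upper unipotent.
  Since \<open>p\<^sup>m L p\<^sup>-\<^sup>m\<close> and \<open>p\<^sup>-\<^sup>m u p\<^sup>m\<close> tend to \<open>1\<close> and a neighbourhood of \<open>p\<close> lies in \<open>S\<close>, the monomial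
  matrix \<open>p\<^sup>m L h u p\<^sup>m\<close> belongs to \<open>S\<close> for large \<open>m\<close>. The product over all adjacent transpositions
  is a monomial \<open>n\<close>-cycle, so its \<open>n\<close>-th power is diagonal with entries of equal absolute value, which
  is \<open>1\<close> by the determinant condition. Its powers accumulate at \<open>1\<close>, so \<open>1\<close> is interior to \<open>S\<close>, and \<open>S\<close> is
  open and closed in the connected group \<open>Sl(n, \<bbbH>)\<close>.\<close>

section \<open>Quaternionic matrices\<close>

definition diag_mat :: "('n \<Rightarrow> quat) \<Rightarrow> quat ^ 'n ^ 'n" where
  "diag_mat t = (\<chi> i j. if i = j then t i else 0)"

lemma diag_mat_nth: "diag_mat t $ i $ j = (if i = j then t i else 0)"
  by (simp add: diag_mat_def)

lemma diag_mat_one: "diag_mat (\<lambda>_. 1) = mat 1"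
  by (simp add: diag_mat_def mat_def)

lemma matrix_mult_nth: "(A ** B) $ i $ j = (\<Sum>k\<in>UNIV. A $ i $ k * B $ k $ j)"
  by (simp add: matrix_matrix_mult_def)

lemma diag_mat_mult_nth: "(diag_mat t ** A) $ i $ j = t i * A $ i $ j"
proof -
  have "(diag_mat t ** A) $ i $ j = (\<Sum>k\<in>UNIV. if i = k then t i * A $ k $ j else 0)"
    unfolding matrix_mult_nth by (rule sum.cong) (auto simp: diag_mat_nth)
  then show ?thesis by simp
qed

lemma mult_diag_mat_nth: "(A ** diag_mat t) $ i $ j = A $ i $ j * t j"
proof -
  have "(A ** diag_mat t) $ i $ j = (\<Sum>k\<in>UNIV. if k = j then A $ i $ k * t k else 0)"
    unfolding matrix_mult_nth by (rule sum.cong) (auto simp: diag_mat_nth)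
  then show ?thesis by simp
qed

lemma diag_mat_mult_diag_mat: "diag_mat a ** diag_mat b = diag_mat (\<lambda>i. a i * b i)"
  by (simp add: vec_eq_iff diag_mat_mult_nth) (simp add: diag_mat_nth)

lemma diag_mat_mult_inverse:
  assumes "\<And>i. t i \<noteq> 0"
  shows "diag_mat t ** diag_mat (\<lambda>i. inverse (t i)) = mat 1" "diag_mat (\<lambda>i. inverse (t i)) ** diag_mat t = mat 1"
  using assms by (simp_all add: diag_mat_mult_diag_mat flip: diag_mat_one)

lemma continuous_on_diag_mat:
  assumes "\<And>i. continuous_on T (\<lambda>s. f s i)"
  shows "continuous_on T (\<lambda>s. diag_mat (f s))"
  unfolding diag_mat_def
proof (intro continuous_on_vec_lambda)
  show "continuous_on T (\<lambda>s. if i = j then f s i else 0)" for i j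
    using assms by (cases "i = j") auto
qed

lemma continuous_on_matrix_mult [continuous_intros]:
  fixes f g :: "'a::topological_space \<Rightarrow> quat ^ 'n ^ 'n"
  assumes "continuous_on T f" "continuous_on T g"
  shows "continuous_on T (\<lambda>x. f x ** g x)"
  unfolding matrix_matrix_mult_def
  by (intro continuous_intros continuous_on_vec_lambda assms)

section \<open>The real determinant: continuity, invertibility, scaling\<close>

lemma continuous_on_real_det: "continuous_on T (real_det :: quat ^ 'n ^ 'n \<Rightarrow> real)"
proof -
  have "continuous_on T (\<lambda>g :: quat ^ 'n ^ 'n. matrix (\<lambda>w. real_coords (g *v quat_coords w)) $ p $ q)"
    for p q
  proof -
    have "continuous_on T (\<lambda>g :: quat ^ 'n ^ 'n. real_coords (g *v quat_coords w) $ (i, c))" for w i c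
    proof -
      have l: "linear (\<lambda>x::quat. qRe x)" "linear (\<lambda>x::quat. qI x)" "linear (\<lambda>x::quat. qJ x)"
        "linear (\<lambda>x::quat. qK x)"
        by (auto intro!: linearI)
      note c = linear_continuous_on_compose[OF _ l(1)] linear_continuous_on_compose[OF _ l(2)]
        linear_continuous_on_compose[OF _ l(3)] linear_continuous_on_compose[OF _ l(4)]
      have m: "continuous_on T (\<lambda>g :: quat ^ 'n ^ 'n. (g *v quat_coords w) $ i)"
        unfolding matrix_vector_mult_def by simp (intro continuous_intros)
      show ?thesis
        using exhaust_4[of c] by (auto simp: real_coords_def intro!: c m)
    qed
    then show ?thesis by (cases p) (simp add: matrix_def)
  qed
  then show ?thesis
    unfolding real_det_def det_def
    by (intro continuous_on_sum continuous_on_mult continuous_on_prod continuous_on_const) blast+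
qed

lemma tendsto_real_det: "(f \<longlongrightarrow> g) F \<Longrightarrow> ((\<lambda>x. real_det (f x)) \<longlongrightarrow> real_det g) F"
  for g :: "quat ^ 'n ^ 'n"
  using continuous_on_tendsto_compose[OF continuous_on_real_det[of UNIV]] by auto

lemma real_det_nonzero_if_inverse:
  assumes "g ** h = mat 1" shows "real_det g \<noteq> 0" "real_det h \<noteq> 0"
proof -
  have "real_det g * real_det h = 1" by (simp add: assms flip: real_det_mult)
  then show "real_det g \<noteq> 0" "real_det h \<noteq> 0" by auto
qed

text \<open>The associated real map is surjective, and preimages of the standard basis vectors form
  the columns of the right inverse.\<close>

lemma right_inverse_if_real_det:
  fixes g :: "quat ^ 'n ^ 'n"
  assumes "real_det g \<noteq> 0"
  shows "\<exists>h. g ** h = mat 1"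
proof -
  let ?f = "\<lambda>w. real_coords (g *v quat_coords w)"
  obtain B where B: "matrix ?f ** B = mat 1"
    using assms invertible_det_nz[of "matrix ?f"] by (auto simp: real_det_def invertible_def)
  have "\<exists>v. g *v v = u" for u
  proof -
    have "?f (B *v real_coords u) = real_coords u"
      using fun_cong[OF matrix_vector_mul(2)[OF linear_real_coords_mult[of g]], of "B *v real_coords u"] B
      by (simp add: matrix_vector_mul_assoc)
    then have "g *v quat_coords (B *v real_coords u) = u"
      by (metis quat_coords_real_coords)
    then show ?thesis by blast
  qed
  then obtain k where k: "\<And>u. g *v k u = u" by metis
  have "g ** (\<chi> i j. k (axis j 1) $ i) = mat 1"
  proof -
    have "(g ** (\<chi> i j. k (axis j 1) $ i)) $ i $ j = (g *v k (axis j 1)) $ i" for i j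
      by (simp add: matrix_mult_nth matrix_vector_mult_def)
    then show ?thesis by (simp add: vec_eq_iff k axis_def mat_def)
  qed
  then show ?thesis by blast
qed

text \<open>The right inverse \<open>h\<close> has nonzero \<open>real_det\<close> too, so it has a
  right inverse \<open>k\<close>, and associativity identifies \<open>k\<close> with
  \<open>g\<close>.\<close>

lemma inverse_if_real_det:
  fixes g :: "quat ^ 'n ^ 'n"
  assumes "real_det g \<noteq> 0"
  shows "\<exists>h. g ** h = mat 1 \<and> h ** g = mat 1"
proof -
  obtain h where h: "g ** h = mat 1" using right_inverse_if_real_det[OF assms] by blast
  obtain k where k: "h ** k = mat 1"
    using right_inverse_if_real_det[OF real_det_nonzero_if_inverse(2)[OF h]] by blast
  have "g = g ** (h ** k)" by (simp add: k)
  also have "\<dots> = k" by (simp add: matrix_mul_assoc h)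
  finally show ?thesis using h k by auto
qed

lemma mem_SL_iff: "g \<in> carrier SL \<longleftrightarrow> real_det g = 1"
  using inverse_if_real_det[of g] by (auto simp: SL_def invertible_def)

text \<open>The exponent is the real dimension of the space of column vectors, on which
  \<open>c\<close> acts as a homothety.\<close>

lemma real_det_scaleR: "real_det (c *\<^sub>R g) = c ^ (CARD('n) * 4) * real_det g"
  for g :: "quat ^ 'n ^ 'n"
proof -
  have e: "c *\<^sub>R g = (c *\<^sub>R mat 1) ** g"
    by (simp add: vec_eq_iff matrix_mult_nth mat_def if_distrib[of "\<lambda>x. x * _"]
        if_distrib[of "\<lambda>x. _ *\<^sub>R x"] cong: if_cong)
  have "real_coords ((c *\<^sub>R mat 1) *v quat_coords w) = c *\<^sub>R w" for w :: "real ^ ('n \<times> 4)"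
  proof -
    have "(c *\<^sub>R mat 1) *v quat_coords w = quat_coords (c *\<^sub>R w)"
      by (simp add: vec_eq_iff matrix_vector_mult_def mat_def if_distrib[of "\<lambda>x. x * _"]
        if_distrib[of "\<lambda>x. _ *\<^sub>R x"] quat_coords_def quat_eq_iff cong: if_cong)
    then show ?thesis by simp
  qed
  then have "real_det (c *\<^sub>R mat 1 :: quat ^ 'n ^ 'n) = det (matrix (\<lambda>w :: real ^ ('n \<times> 4). c *\<^sub>R w))"
    by (simp add: real_det_def)
  also have "\<dots> = c ^ (CARD('n) * 4)"
    by (subst det_diagonal) (auto simp: matrix_def axis_def)
  finally show ?thesis by (simp add: e real_det_mult)
qed

lemma norm_real_coords: "norm (real_coords v) = norm v" for v :: "quat ^ 'n"
proof -
  have "(norm (real_coords v))\<^sup>2 = (\<Sum>p\<in>UNIV \<times> UNIV. (real_coords v $ p)\<^sup>2)"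
    by (simp add: norm_vec_def L2_set_def sum_nonneg)
  also have "\<dots> = (\<Sum>i\<in>UNIV. \<Sum>c\<in>UNIV. (real_coords v $ (i, c))\<^sup>2)"
    by (simp only: sum.cartesian_product case_prod_unfold prod.collapse)
  also have "\<dots> = (\<Sum>i\<in>UNIV. (norm (v $ i))\<^sup>2)"
  proof (rule sum.cong)
    show "(\<Sum>c\<in>UNIV. (real_coords v $ (i, c))\<^sup>2) = (norm (v $ i))\<^sup>2" for i
      unfolding sum_4 by (simp add: real_coords_def norm_quat_def inner_quat_def power2_eq_square)
  qed simp
  also have "\<dots> = (norm v)\<^sup>2"
    by (simp add: norm_vec_def L2_set_def sum_nonneg)
  finally show ?thesis by simp
qed

text \<open>Left multiplication by a unit quaternion in each coordinate preserves the Euclidean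
  norm, so the associated real map is orthogonal.\<close>

lemma abs_real_det_unit_diag_mat:
  fixes q :: "'n::finite \<Rightarrow> quat"
  assumes "\<And>i. norm (q i) = 1"
  shows "\<bar>real_det (diag_mat q)\<bar> = 1"
proof -
  have v: "(diag_mat q *v v) $ i = q i * v $ i" for v i
  proof -
    have "(diag_mat q *v v) $ i = (\<Sum>k\<in>UNIV. if i = k then q i * v $ k else 0)"
      by (simp add: matrix_vector_mult_def diag_mat_nth if_distrib[of "\<lambda>x. x * _"] cong: if_cong)
    then show ?thesis by simp
  qed
  have "norm (diag_mat q *v v) = norm v" for v
    by (simp add: norm_vec_def v norm_mult assms)
  then have "orthogonal_transformation (\<lambda>w. real_coords (diag_mat q *v quat_coords w))"
    unfolding orthogonal_transformation
    by (metis linear_real_coords_mult norm_real_coords real_coords_quat_coords)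
  then show ?thesis by (simp add: real_det_def)
qed

lemma norm_matrix_le_sum: "norm A \<le> (\<Sum>i\<in>UNIV. \<Sum>j\<in>UNIV. norm (A $ i $ j))"
  for A :: "quat ^ 'n ^ 'n"
proof -
  have "norm A \<le> (\<Sum>i\<in>UNIV. norm (A $ i))" by (simp add: norm_vec_def L2_set_le_sum)
  also have "\<dots> \<le> (\<Sum>i\<in>UNIV. \<Sum>j\<in>UNIV. norm (A $ i $ j))"
    by (intro sum_mono) (simp add: norm_vec_def L2_set_le_sum)
  finally show ?thesis .
qed

section \<open>Right eigenvectors\<close>

text \<open>Scalars act on column vectors from the right, so that they commute with the action of
  matrices from the left.\<close>

definition scale_right :: "quat ^ 'n \<Rightarrow> quat \<Rightarrow> quat ^ 'n" where
  "scale_right v z = (\<chi> i. v $ i * z)"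

lemma scale_right_nth: "scale_right v z $ i = v $ i * z"
  by (simp add: scale_right_def)

lemma scale_right_scale_right: "scale_right (scale_right v a) b = scale_right v (a * b)"
  by (simp add: scale_right_def mult.assoc)

lemma scale_right_simps [simp]: "scale_right v 0 = 0" "scale_right 0 a = 0" "scale_right v 1 = v"
  by (simp_all add: scale_right_def vec_eq_iff)

lemma scale_right_add: "scale_right (u + v) a = scale_right u a + scale_right v a" "scale_right v (a + b) = scale_right v a + scale_right v b"
  by (simp_all add: scale_right_def vec_eq_iff distrib_left distrib_right)

lemma scale_right_sum: "scale_right (\<Sum>i\<in>I. f i) a = (\<Sum>i\<in>I. scale_right (f i) a)"
  by (simp add: scale_right_def vec_eq_iff sum_distrib_right)

lemma mult_vec_nth: "(g *v v) $ i = (\<Sum>k\<in>UNIV. g $ i $ k * v $ k)"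
  by (simp add: matrix_vector_mult_def)

lemma mult_vec_add: "g *v (u + v) = g *v u + g *v v" for g :: "quat ^ 'n ^ 'n"
  by (simp add: vec_eq_iff mult_vec_nth distrib_left sum.distrib)

lemma mult_vec_zero: "g *v 0 = 0" for g :: "quat ^ 'n ^ 'n"
  by (simp add: vec_eq_iff mult_vec_nth)

lemma mult_vec_scale_right: "g *v scale_right v a = scale_right (g *v v) a" for g :: "quat ^ 'n ^ 'n"
  by (simp add: vec_eq_iff mult_vec_nth scale_right_nth sum_distrib_right mult.assoc)

lemma mult_vec_sum: "g *v (\<Sum>i\<in>I. f i) = (\<Sum>i\<in>I. g *v f i)" for g :: "quat ^ 'n ^ 'n"
  by (induction I rule: infinite_finite_induct) (simp_all add: mult_vec_add mult_vec_zero)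

section \<open>Complex polynomials acting on quaternionic vectors\<close>

definition complex_quat :: "complex \<Rightarrow> quat" where
  "complex_quat z = Quat (Re z) (Im z) 0 0"

lemma complex_quat_simps [simp]: "complex_quat 0 = 0" "complex_quat 1 = 1" "complex_quat (a + b) = complex_quat a + complex_quat b"
  "complex_quat (a * b) = complex_quat a * complex_quat b" "complex_quat (- a) = - complex_quat a" "complex_quat (of_real r) = r *\<^sub>R 1"
  by (simp_all add: complex_quat_def quat_eq_iff)

lemma complex_quat_commute: "complex_quat a * complex_quat b = complex_quat b * complex_quat a"
  by (simp flip: complex_quat_simps(4) add: mult.commute)

lemma complex_quat_eq_0_iff [simp]: "complex_quat a = 0 \<longleftrightarrow> a = 0"
  by (simp add: complex_quat_def quat_eq_iff complex_eq_iff)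

text \<open>Right multiplication by \<open>\<complex> \<subseteq> \<bbbH>\<close> turns \<open>\<bbbH>\<^sup>n\<close> into a complex vector space on which \<open>g\<close> acts
  linearly; \<open>poly_act g p w\<close> is the value \<open>p(g) w\<close> in that structure.\<close>

definition poly_act :: "quat ^ 'n ^ 'n \<Rightarrow> complex poly \<Rightarrow> quat ^ 'n \<Rightarrow> quat ^ 'n" where
  "poly_act g p w = (\<Sum>i\<le>degree p. scale_right (((*v) g ^^ i) w) (complex_quat (coeff p i)))"

lemma poly_act_eq:
  assumes "degree p \<le> N"
  shows "poly_act g p w = (\<Sum>i\<le>N. scale_right (((*v) g ^^ i) w) (complex_quat (coeff p i)))"
  unfolding poly_act_def using assms
  by (intro sum.mono_neutral_left) (auto simp: coeff_eq_0 not_le)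

lemma poly_act_add: "poly_act g (p + q) w = poly_act g p w + poly_act g q w"
proof -
  define N where "N = max (degree p) (degree q)"
  have "degree (p + q) \<le> N" "degree p \<le> N" "degree q \<le> N"
    by (auto simp: N_def degree_add_le_max)
  then show ?thesis by (simp add: poly_act_eq[of _ N] scale_right_add sum.distrib)
qed

lemma poly_act_smult: "poly_act g (smult c p) w = scale_right (poly_act g p w) (complex_quat c)"
proof -
  have "poly_act g (smult c p) w = (\<Sum>i\<le>degree p. scale_right (((*v) g ^^ i) w) (complex_quat (coeff (smult c p) i)))"
    by (rule poly_act_eq) (rule degree_smult_le)
  also have "\<dots> = scale_right (poly_act g p w) (complex_quat c)"
    by (simp add: poly_act_def scale_right_sum scale_right_scale_right complex_quat_commute[of c])
  finally show ?thesis .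
qed

lemma poly_act_pCons_0: "poly_act g (pCons 0 p) w = g *v poly_act g p w"
proof -
  have "poly_act g (pCons 0 p) w
      = (\<Sum>i\<le>Suc (degree p). scale_right (((*v) g ^^ i) w) (complex_quat (coeff (pCons 0 p) i)))"
    by (rule poly_act_eq) (rule degree_pCons_le)
  also have "\<dots> = g *v poly_act g p w"
    by (simp add: sum.atMost_Suc_shift poly_act_def mult_vec_sum mult_vec_scale_right del: sum.atMost_Suc)
  finally show ?thesis .
qed

lemma poly_act_linear_factor: "poly_act g ([:- \<zeta>, 1:] * q) w = g *v poly_act g q w - scale_right (poly_act g q w) (complex_quat \<zeta>)"
proof -
  have m: "scale_right v (- a) = - scale_right v a" for v :: "quat ^ 'n" and a by (simp add: scale_right_def vec_eq_iff)
  have "[:- \<zeta>, 1:] * q = pCons 0 q + smult (- \<zeta>) q" by simp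
  then show ?thesis by (simp only: poly_act_add poly_act_smult poly_act_pCons_0 complex_quat_simps m) simp
qed

text \<open>There is one more iterate of \<open>g\<close> on \<open>w\<close> than the real
  dimension, which forces a real linear relation; its coefficients are those of
  \<open>p\<close>.\<close>

lemma annihilating_poly: "\<exists>p. p \<noteq> 0 \<and> poly_act g p w = 0" for g :: "quat ^ 'n ^ 'n"
proof -
  define N where "N = DIM(quat ^ 'n)"
  define f where "f i = ((*v) g ^^ i) w" for i
  have "\<exists>c::nat \<Rightarrow> real. (\<exists>i\<le>N. c i \<noteq> 0) \<and> (\<Sum>i\<le>N. c i *\<^sub>R f i) = 0"
  proof (cases "inj_on f {..N}")
    case True
    have "DIM(quat ^ 'n) < card (f ` {..N})"
      unfolding card_image[OF True] by (simp add: N_def del: DIM_cart)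
    then have "dependent (f ` {..N})" by (intro dependent_biggerset)
    then obtain u where u: "\<exists>v\<in>f ` {..N}. u v \<noteq> 0" "(\<Sum>v\<in>f ` {..N}. u v *\<^sub>R v) = 0"
      by (auto simp: dependent_finite)
    then have "(\<Sum>i\<le>N. u (f i) *\<^sub>R f i) = 0" by (simp add: sum.reindex[OF True])
    with u(1) show ?thesis by (intro exI[of _ "\<lambda>i. u (f i)"]) auto
  next
    \<comment> \<open>Coinciding iterates merge in the image set, but the difference of their two
      monomials is already a relation.\<close>
    case False
    then obtain i j where ij: "i \<le> N" "j \<le> N" "i \<noteq> j" "f i = f j" by (auto simp: inj_on_def)
    define c where "c l = (if l = i then 1 else 0) - (if l = j then 1 else (0::real))" for l
    have "(\<Sum>l\<le>N. c l *\<^sub>R f l)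
        = (\<Sum>l\<le>N. if l = i then f l else 0) - (\<Sum>l\<le>N. if l = j then f l else 0)"
      unfolding sum_subtractf[symmetric] by (rule sum.cong) (auto simp: c_def)
    with ij have "(\<Sum>l\<le>N. c l *\<^sub>R f l) = 0" by simp
    moreover have "c i \<noteq> 0" using ij by (simp add: c_def)
    ultimately show ?thesis using ij(1) by blast
  qed
  then obtain c where c: "\<exists>i\<le>N. c i \<noteq> (0::real)" "(\<Sum>i\<le>N. c i *\<^sub>R f i) = 0" by blast
  define p where "p = (\<Sum>i\<le>N. monom (complex_of_real (c i)) i)"
  have cf: "coeff p i = (if i \<le> N then of_real (c i) else 0)" for i
    by (simp add: p_def coeff_sum)
  have "p \<noteq> 0" using c(1) cf by (metis coeff_0 of_real_eq_0_iff)
  moreover have "degree p \<le> N" by (rule degree_le) (simp add: cf)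
  then have "poly_act g p w = (\<Sum>i\<le>N. scale_right (f i) (complex_quat (of_real (c i))))"
    by (simp add: poly_act_eq[of p N] cf f_def del: complex_quat_simps)
  then have "poly_act g p w = 0" using c(2) by (simp add: scale_right_def vec_eq_iff)
  ultimately show ?thesis by blast
qed

text \<open>Linear factors are split off a polynomial \<open>p\<close> with \<open>p(g) w\<close> in
  \<open>U\<close>. Since \<open>w\<close> lies outside \<open>U\<close>, at some factor the vector
  \<open>q(g) w\<close> leaves \<open>U\<close>, and this vector is an eigenvector modulo
  \<open>U\<close>.\<close>

lemma right_eigenvector_mod:
  fixes g :: "quat ^ 'n ^ 'n"
  assumes "0 \<in> U" and scaleU: "\<And>v a. v \<in> U \<Longrightarrow> scale_right v a \<in> U" and w: "w \<notin> U"
  shows "\<exists>v a. v \<notin> U \<and> g *v v - scale_right v a \<in> U"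
proof -
  have "p \<noteq> 0 \<Longrightarrow> poly_act g p w \<in> U \<Longrightarrow> ?thesis" for p
  proof (induction "degree p" arbitrary: p)
    case 0
    then obtain c where p: "p = [:c:]" "c \<noteq> 0" by (metis degree_eq_zeroE pCons_eq_0_iff)
    have "scale_right (scale_right w (complex_quat c)) (inverse (complex_quat c)) \<in> U" using 0 by (intro scaleU[of "scale_right w (complex_quat c)"]) (simp add: p poly_act_def)
    moreover have "complex_quat c * inverse (complex_quat c) = 1" using p(2) by simp
    ultimately have "w \<in> U" by (simp only: scale_right_scale_right scale_right_simps)
    with w show ?case by simp
  next
    case (Suc d)
    then obtain \<zeta> where "poly p \<zeta> = 0"
      using fundamental_theorem_of_algebra[of p] by (auto simp: constant_degree)
    then obtain q where p: "p = [:- \<zeta>, 1:] * q" by (auto simp: poly_eq_0_iff_dvd)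
    with Suc.prems have q: "q \<noteq> 0" by auto
    have "d = degree q" using Suc.hyps(2) q by (simp add: p degree_mult_eq del: mult_pCons_left)
    show ?case
    proof (cases "poly_act g q w \<in> U")
      case True
      then show ?thesis using Suc.hyps(1)[OF \<open>d = degree q\<close> q] by blast
    next
      case False
      with Suc.prems(2) show ?thesis unfolding p poly_act_linear_factor by blast
    qed
  qed
  moreover obtain p where "p \<noteq> 0" "poly_act g p w = 0" using annihilating_poly by blast
  ultimately show ?thesis using \<open>0 \<in> U\<close> by simp
qed

text \<open>A kernel element of this real-linear map satisfies
  \<open>norm w * norm b = norm a * norm w\<close>, hence is zero; in finite dimension the map is
  then surjective.\<close>

lemma sylvester_quat:
  fixes a b c :: quat
  assumes "norm a \<noteq> norm b"
  shows "\<exists>w. w * b - a * w = c"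
proof -
  have l: "linear (\<lambda>w. w * b - a * w)"
    by (rule linearI) (simp_all add: algebra_simps)
  have "w = 0" if "w * b - a * w = 0" for w
  proof -
    from that have "norm (w * b) = norm (a * w)" by simp
    with assms show "w = 0" by (auto simp: norm_mult)
  qed
  then have "inj (\<lambda>w. w * b - a * w)" by (simp add: linear_injective_0[OF l])
  then have "surj (\<lambda>w. w * b - a * w)" by (simp add: l linear_injective_imp_surjective)
  then obtain w where "c = w * b - a * w" by (rule surjE)
  then show ?thesis by blast
qed

section \<open>Density of diagonalizable matrices\<close>

text \<open>The inverse is carried as an explicit matrix, so that a change of basis and its inverse
  can be perturbed together in a product space.\<close>

definition inverse_pair :: "quat ^ 'n ^ 'n \<Rightarrow> quat ^ 'n ^ 'n \<Rightarrow> bool" where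
  "inverse_pair x y \<longleftrightarrow> x ** y = mat 1 \<and> y ** x = mat 1"

lemma inverse_pair_mult: "inverse_pair a b \<Longrightarrow> inverse_pair c d \<Longrightarrow> inverse_pair (a ** c) (d ** b)"
  unfolding inverse_pair_def by (metis matrix_mul_assoc matrix_mul_lid)

lemma inverse_pair_cancel:
  assumes "inverse_pair x y"
  shows "x ** (y ** a) = a" "y ** (x ** a) = a" "a ** x ** y = a" "a ** y ** x = a"
  using assms by (simp_all add: inverse_pair_def matrix_mul_assoc) (simp_all add: matrix_mul_assoc[symmetric])

lemma real_det_conj:
  assumes "inverse_pair x y" shows "real_det (x ** g ** y) = real_det g"
proof -
  have "real_det x * real_det y = 1" using assms by (simp add: inverse_pair_def flip: real_det_mult)
  then show ?thesis by (simp add: real_det_mult mult.assoc mult.commute[of "real_det g"])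
qed

text \<open>As a change of basis it puts \<open>u\<close> in the place of the basis vector with
  index \<open>m\<close> and keeps all others.\<close>

definition replace_col :: "'n \<Rightarrow> ('n \<Rightarrow> quat) \<Rightarrow> quat ^ 'n ^ 'n" where
  "replace_col m u = (\<chi> i j. if j = m then u i else if i = j then 1 else 0)"

lemma replace_col_nth: "replace_col m u $ i $ j = (if j = m then u i else if i = j then 1 else 0)"
  by (simp add: replace_col_def)

lemma replace_col_mult:
  "replace_col m u ** replace_col m w
    = replace_col m (\<lambda>i. u i * w m + (if i = m then 0 else w i))"
proof -
  have "(replace_col m u ** replace_col m w) $ i $ j
      = replace_col m (\<lambda>i. u i * w m + (if i = m then 0 else w i)) $ i $ j" for i j
  proof (cases "j = m")
    case True
    have "(replace_col m u ** replace_col m w) $ i $ j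
        = (\<Sum>k\<in>UNIV. (if k = m then u i * w m else 0) + (if k = i then if i = m then 0 else w i else 0))"
      unfolding matrix_mult_nth using True by (intro sum.cong) (auto simp: replace_col_nth)
    then show ?thesis using True by (simp add: sum.distrib replace_col_nth)
  next
    case False
    have "(replace_col m u ** replace_col m w) $ i $ j
        = (\<Sum>k\<in>UNIV. if k = j then replace_col m u $ i $ j else 0)"
      unfolding matrix_mult_nth using False by (intro sum.cong) (auto simp: replace_col_nth)
    then show ?thesis using False by (simp add: replace_col_nth)
  qed
  then show ?thesis by (simp add: vec_eq_iff)
qed

lemma inverse_pair_replace_col:
  assumes "u m \<noteq> 0"
  shows "inverse_pair (replace_col m u)
    (replace_col m (\<lambda>i. if i = m then inverse (u m) else - u i * inverse (u m)))"
  using assms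
  by (auto simp: inverse_pair_def replace_col_mult vec_eq_iff replace_col_nth mat_def mult.assoc)

text \<open>Moving outwards along a ray through \<open>a\<close> realizes a whole interval of norms,
  which the finite set \<open>B\<close> cannot exhaust.\<close>

lemma exists_near_norm_avoiding:
  fixes a :: quat
  assumes "\<delta> > 0" "finite B"
  shows "\<exists>b. dist a b < \<delta> \<and> norm b \<notin> B"
proof -
  define u where "u = (if a = 0 then 1 else sgn a)"
  have u: "norm u = 1" "a = norm a *\<^sub>R u"
    by (auto simp: u_def norm_sgn sgn_div_norm)
  have "infinite ({norm a <..< norm a + \<delta>} - B)"
    using assms by (intro Diff_infinite_finite) (auto simp: infinite_Ioo)
  then obtain r where r: "norm a < r" "r < norm a + \<delta>" "r \<notin> B"
    by (metis DiffE ex_in_conv finite.emptyI greaterThanLessThan_iff)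
  have "dist a (r *\<^sub>R u) = norm ((norm a - r) *\<^sub>R u)"
    by (subst u(2)) (simp add: dist_norm scaleR_left_diff_distrib)
  also have "\<dots> < \<delta>" using r u by simp
  finally have "dist a (r *\<^sub>R u) < \<delta>" .
  moreover have "norm (r *\<^sub>R u) = r" using order_trans[OF norm_ge_zero less_imp_le[OF r(1)]] u(1) by simp
  ultimately show ?thesis using r(3) by metis
qed

text \<open>Induction step of the diagonalization: an eigenvector modulo the span of the basis
  vectors in \<open>J\<close> is found, its eigenvalue is moved slightly to a fresh norm, and a
  Sylvester equation corrects the vector to a true eigenvector.\<close>

lemma add_eigenvector:
  fixes g :: "quat ^ 'n ^ 'n"
  assumes "open W" "g \<in> W" "inverse_pair x y" "J \<noteq> UNIV"
    and diag: "\<And>i j. j \<in> J \<Longrightarrow> (y ** g ** x) $ i $ j = diag_mat t $ i $ j"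
    and t: "inj_on (\<lambda>j. norm (t j)) J" "\<And>j. j \<in> J \<Longrightarrow> t j \<noteq> 0"
  shows "\<exists>m g' x' y' b. m \<notin> J \<and> g' \<in> W \<and> inverse_pair x' y' \<and>
    (\<forall>i. \<forall>j\<in>insert m J. (y' ** g' ** x') $ i $ j = diag_mat (t(m := b)) $ i $ j) \<and>
    norm b \<notin> (\<lambda>j. norm (t j)) ` J \<and> b \<noteq> 0"
proof -
  define T where "T = y ** g ** x"
  define U where "U = {v :: quat ^ 'n. \<forall>i. i \<notin> J \<longrightarrow> v $ i = 0}"
  obtain m0 where "m0 \<notin> J" using assms(4) by blast
  then have "axis m0 1 \<notin> U" by (auto simp: U_def axis_def)
  moreover have "0 \<in> U" "\<And>v a. v \<in> U \<Longrightarrow> scale_right v a \<in> U" by (auto simp: U_def scale_right_nth)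
  ultimately obtain v a where v: "v \<notin> U" "T *v v - scale_right v a \<in> U"
    using right_eigenvector_mod[of U _ T] by blast
  then obtain m where m: "m \<notin> J" "v $ m \<noteq> 0" by (auto simp: U_def)
  \<comment> \<open>Adding \<open>M b\<close> changes the eigenvalue of \<open>v\<close> modulo
    \<open>U\<close> from \<open>a\<close> to \<open>b\<close>. Only column \<open>m\<close> is
    touched, so the columns in \<open>J\<close> stay diagonal.\<close>
  define M where "M b = (\<chi> i j. if j = m then v $ i * (b - a) * inverse (v $ m) else 0)" for b
  have cM: "continuous_on UNIV M"
    unfolding M_def
  proof (intro continuous_on_vec_lambda)
    show "continuous_on UNIV (\<lambda>b. if j = m then v $ i * (b - a) * inverse (v $ m) else 0)" for i j
      by (cases "j = m") (auto intro!: continuous_intros)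
  qed
  define F where "F b = x ** (T + M b) ** y" for b
  have "continuous_on UNIV F" unfolding F_def by (intro continuous_intros cM)
  then have "open (F -` W)" using \<open>open W\<close> by (simp add: continuous_on_open_vimage)
  moreover have "F a = g"
  proof -
    have "M a = 0" by (simp add: M_def vec_eq_iff)
    then have "F a = x ** (y ** (g ** x)) ** y" by (simp add: F_def T_def matrix_mul_assoc)
    then show ?thesis using assms(3) by (simp only: inverse_pair_cancel)
  qed
  ultimately obtain \<delta> where \<delta>: "\<delta> > 0" "ball a \<delta> \<subseteq> F -` W"
    using \<open>g \<in> W\<close> by (metis openE vimage_eq)
  obtain b where b: "dist a b < \<delta>" "norm b \<notin> insert 0 ((\<lambda>j. norm (t j)) ` J)"
    using exists_near_norm_avoiding[OF \<delta>(1)] by (metis finite finite_imageI finite_insert)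
  define T' where "T' = T + M b"
  have T'J: "T' $ i $ j = diag_mat t $ i $ j" if "j \<in> J" for i j
    using that m(1) diag[OF that] by (auto simp: T'_def T_def M_def)
  have "(M b *v v) $ i = v $ i * (b - a)" for i
  proof -
    have "(M b *v v) $ i = (\<Sum>k\<in>UNIV. if k = m then v $ i * (b - a) * inverse (v $ m) * v $ m else 0)"
      unfolding mult_vec_nth by (rule sum.cong) (auto simp: M_def)
    then show ?thesis using m(2) by (simp add: mult.assoc)
  qed
  then have T'v: "(T' *v v) $ i = (T *v v) $ i + v $ i * (b - a)" for i
    by (simp add: T'_def mult_vec_nth distrib_right sum.distrib)
  \<comment> \<open>The correction \<open>w\<close> is supported on \<open>J\<close>, where
    \<open>T'\<close> acts by the entries \<open>t i\<close>. The eigenvector equation for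
    \<open>v + w\<close> then splits into one Sylvester equation for each \<open>i\<close> in
    \<open>J\<close>.\<close>
  have "\<forall>i\<in>J. \<exists>w. w * b - t i * w = (T' *v v) $ i - v $ i * b"
  proof (intro ballI sylvester_quat)
    show "norm (t i) \<noteq> norm b" if "i \<in> J" for i
      using b(2) that by (metis image_eqI insertCI)
  qed
  from bchoice[OF this] obtain w
    where w: "\<And>i. i \<in> J \<Longrightarrow> w i * b - t i * w i = (T' *v v) $ i - v $ i * b"
    by blast
  define u where "u i = v $ i + (if i \<in> J then w i else 0)" for i
  have u: "(\<Sum>k\<in>UNIV. T' $ i $ k * u k) = u i * b" for i
  proof -
    have "(\<Sum>k\<in>UNIV. T' $ i $ k * u k)
        = (T' *v v) $ i + (\<Sum>k\<in>UNIV. if k \<in> J then T' $ i $ k * w k else 0)"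
      unfolding mult_vec_nth sum.distrib[symmetric]
      by (rule sum.cong) (auto simp: u_def distrib_left)
    also have "(\<Sum>k\<in>UNIV. if k \<in> J then T' $ i $ k * w k else 0)
        = (\<Sum>k\<in>UNIV. if k = i then if i \<in> J then t i * w i else 0 else 0)"
      by (rule sum.cong) (auto simp: T'J diag_mat_nth)
    also have "\<dots> = (if i \<in> J then t i * w i else 0)" by simp
    also have "(T' *v v) $ i + \<dots> = u i * b"
    proof (cases "i \<in> J")
      case True
      then show ?thesis using w[OF True] by (simp add: u_def algebra_simps)
    next
      case False
      then have "(T *v v) $ i = v $ i * a" using v(2) by (auto simp: U_def scale_right_nth)
      then show ?thesis using False by (simp add: T'v u_def algebra_simps)
    qed
    finally show ?thesis .
  qed
  define z where "z = replace_col m u"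
  obtain z' where z: "inverse_pair z z'"
    using inverse_pair_replace_col[of u m] m by (auto simp: z_def u_def)
  have Tz: "(T' ** z) $ i $ j = (z ** diag_mat (t(m := b))) $ i $ j" if "j \<in> insert m J" for i j
  proof (cases "j = m")
    case True
    then show ?thesis
      by (simp add: mult_diag_mat_nth u[of i, symmetric]) (simp add: matrix_mult_nth z_def replace_col_nth u)
  next
    case False
    then have "(T' ** z) $ i $ j = (\<Sum>k\<in>UNIV. if k = j then T' $ i $ j else 0)"
      unfolding matrix_mult_nth by (intro sum.cong) (auto simp: z_def replace_col_nth)
    then show ?thesis using False that T'J[of j i]
      by (simp add: mult_diag_mat_nth z_def replace_col_nth diag_mat_nth)
  qed
  have "(z' ** T' ** z) $ i $ j = diag_mat (t(m := b)) $ i $ j" if "j \<in> insert m J" for i j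
  proof -
    have "(z' ** T' ** z) $ i $ j = (z' ** (z ** diag_mat (t(m := b)))) $ i $ j"
      unfolding matrix_mul_assoc[symmetric] matrix_mult_nth[of z']
      by (simp add: Tz[OF that])
    then show ?thesis using z by (simp only: inverse_pair_cancel)
  qed
  moreover have "z' ** T' ** z = (z' ** y) ** F b ** (x ** z)"
  proof -
    have "(z' ** y) ** F b ** (x ** z) = z' ** (y ** (x ** (T' ** (y ** (x ** z)))))"
      by (simp add: F_def T'_def matrix_mul_assoc)
    then show ?thesis using assms(3) by (simp only: inverse_pair_cancel) (simp add: matrix_mul_assoc)
  qed
  moreover have "F b \<in> W" using \<delta>(2) b(1) by auto
  moreover have "inverse_pair (x ** z) (z' ** y)" by (rule inverse_pair_mult[OF assms(3) z])
  moreover have "norm b \<notin> (\<lambda>j. norm (t j)) ` J" "b \<noteq> 0" using b(2) by auto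
  ultimately show ?thesis using m(1)
    by (intro exI[of _ m] exI[of _ "F b"] exI[of _ "x ** z"] exI[of _ "z' ** y"] exI[of _ b]) auto
qed

text \<open>Induction on the number of columns already diagonalized, each step staying inside the
  open set \<open>W\<close>.\<close>

lemma diagonalizable_dense:
  fixes g :: "quat ^ 'n ^ 'n"
  assumes "open W" "g \<in> W"
  shows "\<exists>x y t. inverse_pair x y \<and> x ** diag_mat t ** y \<in> W \<and> inj (\<lambda>j. norm (t j)) \<and> (\<forall>j. t j \<noteq> 0)"
proof -
  have "\<exists>J g' x y t. card J = k \<and> g' \<in> W \<and> inverse_pair x y \<and>
      (\<forall>i. \<forall>j\<in>J. (y ** g' ** x) $ i $ j = diag_mat t $ i $ j) \<and>
      inj_on (\<lambda>j. norm (t j)) J \<and> (\<forall>j\<in>J. t j \<noteq> 0)" if "k \<le> CARD('n)" for k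
    using that
  proof (induction k)
    case 0
    have "inverse_pair (mat 1 :: quat ^ 'n ^ 'n) (mat 1)" by (simp add: inverse_pair_def)
    then show ?case using \<open>g \<in> W\<close> by (intro exI[of _ "{}"] exI[of _ g] exI[of _ "mat 1"]) auto
  next
    case (Suc k)
    from Suc.IH[OF Suc_leD[OF Suc.prems]] obtain J g' x y t where *: "card J = k" "g' \<in> W" "inverse_pair x y"
      "\<And>i j. j \<in> J \<Longrightarrow> (y ** g' ** x) $ i $ j = diag_mat t $ i $ j"
      "inj_on (\<lambda>j. norm (t j)) J" "\<And>j. j \<in> J \<Longrightarrow> t j \<noteq> 0"
      by (elim exE conjE) (rule that, blast+)
    have "J \<noteq> UNIV" using *(1) Suc.prems by auto
    have "\<exists>m g' x' y' b. m \<notin> J \<and> g' \<in> W \<and> inverse_pair x' y' \<and>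
        (\<forall>i. \<forall>j\<in>insert m J. (y' ** g' ** x') $ i $ j = diag_mat (t(m := b)) $ i $ j) \<and>
        norm b \<notin> (\<lambda>j. norm (t j)) ` J \<and> b \<noteq> 0"
      by (rule add_eigenvector[OF \<open>open W\<close> *(2,3) \<open>J \<noteq> UNIV\<close> *(4-6)])
    then obtain m g'' x' y' b where **: "m \<notin> J" "g'' \<in> W" "inverse_pair x' y'"
      "\<forall>i. \<forall>j\<in>insert m J. (y' ** g'' ** x') $ i $ j = diag_mat (t(m := b)) $ i $ j"
      "norm b \<notin> (\<lambda>j. norm (t j)) ` J" "b \<noteq> 0"
      by (elim exE conjE) (rule that)
    define t' where "t' = t(m := b)"
    have t': "t' m = b" "\<And>j. j \<in> J \<Longrightarrow> t' j = t j" using **(1) by (auto simp: t'_def)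
    have "inj_on (\<lambda>j. norm (t' j)) J" using *(5) by (simp add: inj_on_def t'(2))
    moreover have "norm (t' m) \<notin> (\<lambda>j. norm (t' j)) ` (J - {m})"
      using **(5) by (auto simp: t')
    ultimately have "inj_on (\<lambda>j. norm (t' j)) (insert m J)"
      by (simp only: inj_on_insert simp_thms)
    moreover have "card (insert m J) = Suc k" using *(1) **(1) by simp
    moreover have "\<forall>j\<in>insert m J. t' j \<noteq> 0" using *(6) **(6) by (auto simp: t')
    ultimately show ?case using **(2-4)[folded t'_def]
      by (intro exI[of _ "insert m J"] exI[of _ g''] exI[of _ x'] exI[of _ y'] exI[of _ t'] conjI)
  qed
  from this[OF order_refl] obtain J g' x y t where *: "card J = CARD('n)" "g' \<in> W" "inverse_pair x y"
      "\<forall>i. \<forall>j\<in>J. (y ** g' ** x) $ i $ j = diag_mat t $ i $ j"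
      "inj_on (\<lambda>j. norm (t j)) J" "\<forall>j\<in>J. t j \<noteq> 0"
    by blast
  have J: "J = UNIV" using *(1) by (simp add: card_eq_UNIV_imp_eq_UNIV)
  with *(4) have "y ** g' ** x = diag_mat t" by (simp add: vec_eq_iff)
  then have "x ** diag_mat t ** y = x ** (y ** (g' ** x)) ** y" by (simp add: matrix_mul_assoc)
  then have "x ** diag_mat t ** y = g'" using *(3) by (simp only: inverse_pair_cancel)
  with *(2,3,5,6) show ?thesis
    unfolding J by (intro exI[of _ x] exI[of _ y] exI[of _ t]) simp
qed

text \<open>Density survives the restriction to \<open>SL\<close>: near \<open>SL\<close> a matrix can be rescaled by a power of
  its determinant.\<close>

definition sl_normalize :: "quat ^ 'n ^ 'n \<Rightarrow> quat ^ 'n ^ 'n" where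
  "sl_normalize g = root (CARD('n) * 4) (inverse (real_det g)) *\<^sub>R g"

lemma continuous_on_sl_normalize:
  "continuous_on {g :: quat ^ 'n ^ 'n. real_det g > 0} sl_normalize"
  unfolding sl_normalize_def
  by (intro continuous_intros continuous_on_real_det) auto

lemma sl_normalize_SL: "real_det g = 1 \<Longrightarrow> sl_normalize g = g"
  by (simp add: sl_normalize_def)

lemma real_det_sl_normalize: "real_det g > 0 \<Longrightarrow> real_det (sl_normalize g) = 1"
  by (simp add: sl_normalize_def real_det_scaleR real_root_pow_pos2)

lemma scaleR_conj_diag_mat: "c *\<^sub>R (x ** diag_mat t ** y) = x ** diag_mat (\<lambda>i. c *\<^sub>R t i) ** y"
proof -
  have "(x ** diag_mat (\<lambda>i. c *\<^sub>R t i)) $ i $ j = c *\<^sub>R (x ** diag_mat t) $ i $ j" for i j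
    by (simp add: mult_diag_mat_nth)
  then show ?thesis
    by (simp add: vec_eq_iff matrix_mult_nth[of _ y] scaleR_sum_right)
qed

text \<open>Density is applied to the preimage of \<open>W\<close> under
  \<open>sl_normalize\<close>. Normalizing multiplies all eigenvalues by one positive real number,
  so their norms stay distinct.\<close>

lemma diagonalizable_dense_SL:
  fixes g :: "quat ^ 'n ^ 'n"
  assumes "open W" "g \<in> W" "g \<in> carrier SL"
  shows "\<exists>x y t. inverse_pair x y \<and> x ** diag_mat t ** y \<in> W \<and> x ** diag_mat t ** y \<in> carrier SL \<and>
    inj (\<lambda>j. norm (t j)) \<and> (\<forall>j. t j \<noteq> 0)"
proof -
  let ?P = "{g :: quat ^ 'n ^ 'n. real_det g > 0}"
  have "open ?P"
    by (rule open_Collect_less) (intro continuous_on_const continuous_on_real_det)+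
  then have "open (?P \<inter> sl_normalize -` W)"
    using continuous_on_open_vimage[OF \<open>open ?P\<close>] continuous_on_sl_normalize \<open>open W\<close>
    by (metis Int_commute)
  moreover have "g \<in> ?P \<inter> sl_normalize -` W"
    using assms by (simp add: mem_SL_iff sl_normalize_SL)
  ultimately obtain x y t where *: "inverse_pair x y" "x ** diag_mat t ** y \<in> ?P \<inter> sl_normalize -` W"
    "inj (\<lambda>j. norm (t j))" "\<forall>j. t j \<noteq> 0"
    using diagonalizable_dense[of "?P \<inter> sl_normalize -` W" g] by auto
  define c where "c = root (CARD('n) * 4) (inverse (real_det (x ** diag_mat t ** y)))"
  have "c > 0" using *(2) by (simp add: c_def)
  have e: "sl_normalize (x ** diag_mat t ** y) = x ** diag_mat (\<lambda>i. c *\<^sub>R t i) ** y"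
    by (simp add: sl_normalize_def c_def[symmetric] scaleR_conj_diag_mat)
  have "inj (\<lambda>j. norm (c *\<^sub>R t j))" using *(3) \<open>c > 0\<close> by (auto simp: inj_on_def)
  moreover have "\<forall>j. c *\<^sub>R t j \<noteq> 0" using *(4) \<open>c > 0\<close> by simp
  moreover have "x ** diag_mat (\<lambda>i. c *\<^sub>R t i) ** y \<in> W" using *(2) by (simp add: e[symmetric])
  moreover have "x ** diag_mat (\<lambda>i. c *\<^sub>R t i) ** y \<in> carrier SL"
    using *(2) real_det_sl_normalize[of "x ** diag_mat t ** y"] by (simp add: e[symmetric] mem_SL_iff)
  ultimately show ?thesis using *(1) by metis
qed

section \<open>Generic position\<close>

definition elem_mat :: "'n \<Rightarrow> 'n \<Rightarrow> quat \<Rightarrow> quat ^ 'n ^ 'n" where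
  "elem_mat a b c = (\<chi> i j. (if i = j then 1 else 0) + (if i = a \<and> j = b then c else 0))"

lemma elem_mat_nth: "elem_mat a b c $ i $ j = (if i = j then 1 else 0) + (if i = a \<and> j = b then c else 0)"
  by (simp add: elem_mat_def)

lemma mult_elem_mat_nth: "(x ** elem_mat a b c) $ i $ j = x $ i $ j + (if j = b then x $ i $ a * c else 0)"
proof -
  have "(x ** elem_mat a b c) $ i $ j
      = (\<Sum>k\<in>UNIV. (if k = j then x $ i $ j else 0) + (if k = a then if j = b then x $ i $ a * c else 0 else 0))"
    unfolding matrix_mult_nth by (rule sum.cong) (auto simp: elem_mat_nth distrib_left)
  then show ?thesis by (simp add: sum.distrib)
qed

lemma elem_mat_mult_nth: "(elem_mat a b c ** y) $ i $ j = y $ i $ j + (if i = a then c * y $ b $ j else 0)"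
proof -
  have "(elem_mat a b c ** y) $ i $ j
      = (\<Sum>k\<in>UNIV. (if k = i then y $ i $ j else 0) + (if k = b then if i = a then c * y $ b $ j else 0 else 0))"
    unfolding matrix_mult_nth by (rule sum.cong) (auto simp: elem_mat_nth distrib_right)
  then show ?thesis by (simp add: sum.distrib)
qed

lemma inverse_pair_elem_mat:
  assumes "a \<noteq> b" shows "inverse_pair (elem_mat a b c) (elem_mat a b (- c))"
proof -
  have "elem_mat a b c ** elem_mat a b (- c) = mat 1" for c
    using assms by (auto simp: vec_eq_iff mult_elem_mat_nth elem_mat_nth mat_def)
  from this[of c] this[of "- c"] show ?thesis by (simp add: inverse_pair_def)
qed

text \<open>Both components depend continuously on \<open>\<tau>\<close>, with value
  \<open>(x, y)\<close> at 0. For distinct \<open>a\<close> and \<open>b\<close> the two elementary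
  factors are mutually inverse, so inverse pairs stay inverse pairs.\<close>

lemma perturb_elem_mat:
  fixes x y :: "quat ^ 'n ^ 'n"
  assumes "open W" "(x, y) \<in> W"
  shows "\<exists>\<tau>::real. \<tau> \<noteq> 0 \<and> (x ** elem_mat a b (of_real \<tau>), elem_mat a b (- of_real \<tau>) ** y) \<in> W"
proof -
  define F where "F \<tau> = (x ** elem_mat a b (of_real \<tau>), elem_mat a b (- of_real \<tau>) ** y)" for \<tau> :: real
  have cel: "continuous_on UNIV (\<lambda>\<tau>::real. elem_mat a b (f \<tau>))" if "continuous_on UNIV f" for f
    unfolding elem_mat_def
  proof (intro continuous_on_vec_lambda continuous_on_add continuous_on_const)
    show "continuous_on UNIV (\<lambda>\<tau>. if i = a \<and> j = b then f \<tau> else 0)" for i j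
      using that by (cases "i = a \<and> j = b") auto
  qed
  have "continuous_on UNIV F"
    unfolding F_def by (intro continuous_intros cel)
  then have "open (F -` W)" using assms by (simp add: continuous_on_open_vimage)
  moreover have "F 0 = (x, y)" by (simp add: F_def vec_eq_iff mult_elem_mat_nth elem_mat_mult_nth)
  ultimately obtain \<delta> where \<delta>: "\<delta> > 0" "ball 0 \<delta> \<subseteq> F -` W"
    using assms(2) by (metis openE vimage_eq)
  have "\<delta> / 2 \<in> ball 0 \<delta>" using \<delta>(1) by simp
  with \<delta>(2) have "F (\<delta> / 2) \<in> W" by blast
  with \<delta>(1) show ?thesis unfolding F_def by (intro exI[of _ "\<delta> / 2"] conjI) auto
qed

lemma row_nonzero:
  assumes "inverse_pair x y" shows "\<exists>a. x $ r $ a \<noteq> 0"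
proof (rule ccontr)
  assume "\<not> ?thesis"
  then have "(x ** y) $ r $ r = 0" by (simp add: matrix_mult_nth)
  with assms show False by (simp add: inverse_pair_def mat_def)
qed

lemma col_nonzero:
  assumes "inverse_pair x y" shows "\<exists>a. x $ a $ s \<noteq> 0"
proof (rule ccontr)
  assume "\<not> ?thesis"
  then have "(y ** x) $ s $ s = 0" by (simp add: matrix_mult_nth)
  with assms show False by (simp add: inverse_pair_def mat_def)
qed

lemma inverse_pair_sym: "inverse_pair x y \<Longrightarrow> inverse_pair y x"
  by (simp add: inverse_pair_def)

text \<open>Row \<open>r\<close> has a nonzero entry in some column \<open>b\<close>; a small
  multiple of that column is added to column \<open>a\<close>.\<close>

lemma perturb_row_entry:
  assumes "open W" "(x, y) \<in> W" "inverse_pair x y"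
  shows "\<exists>x' y'. (x', y') \<in> W \<and> inverse_pair x' y' \<and> x' $ r $ a \<noteq> 0"
proof (cases "x $ r $ a = 0")
  case True
  obtain b where b: "x $ r $ b \<noteq> 0" using row_nonzero[OF assms(3)] by blast
  with True have "b \<noteq> a" by auto
  obtain \<tau> where "\<tau> \<noteq> 0" "(x ** elem_mat b a (of_real \<tau>), elem_mat b a (- of_real \<tau>) ** y) \<in> W"
    using perturb_elem_mat[OF assms(1,2)] by blast
  with True b show ?thesis
    using inverse_pair_mult[OF assms(3) inverse_pair_elem_mat[OF \<open>b \<noteq> a\<close>]]
    by (intro exI[of _ "x ** elem_mat b a (of_real \<tau>)"] exI[of _ "elem_mat b a (- of_real \<tau>) ** y"])
      (simp add: mult_elem_mat_nth)
qed (use assms in blast)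

lemma perturb_col_entry:
  assumes "open W" "(x, y) \<in> W" "inverse_pair x y"
  shows "\<exists>x' y'. (x', y') \<in> W \<and> inverse_pair x' y' \<and> y' $ b $ s \<noteq> 0"
proof (cases "y $ b $ s = 0")
  case True
  obtain a where a: "y $ a $ s \<noteq> 0" using col_nonzero[OF inverse_pair_sym[OF assms(3)]] by blast
  with True have "b \<noteq> a" by auto
  obtain \<tau> where "\<tau> \<noteq> 0" "(x ** elem_mat b a (of_real \<tau>), elem_mat b a (- of_real \<tau>) ** y) \<in> W"
    using perturb_elem_mat[OF assms(1,2)] by blast
  with True a show ?thesis
    using inverse_pair_mult[OF assms(3) inverse_pair_elem_mat[OF \<open>b \<noteq> a\<close>]]
    by (intro exI[of _ "x ** elem_mat b a (of_real \<tau>)"] exI[of _ "elem_mat b a (- of_real \<tau>) ** y"])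
      (simp add: elem_mat_mult_nth)
qed (use assms in blast)

text \<open>For \<open>a\<close> in \<open>J\<close> and \<open>b\<close> outside \<open>J\<close>,
  a shear in the plane of \<open>a\<close> and \<open>b\<close> changes the sum by a multiple of
  \<open>x $ r $ a\<close> and \<open>y $ b $ s\<close>. Both entries are made nonzero
  first.\<close>

lemma perturb_partial_sum:
  assumes "open W" "(x, y) \<in> W" "inverse_pair x y" "J \<noteq> {}" "J \<noteq> UNIV"
  shows "\<exists>x' y'. (x', y') \<in> W \<and> inverse_pair x' y' \<and> (\<Sum>i\<in>J. x' $ r $ i * y' $ i $ s) \<noteq> 0"
proof -
  obtain a b where ab: "a \<in> J" "b \<notin> J" using assms(4,5) by blast
  obtain x1 y1 where 1: "(x1, y1) \<in> W" "inverse_pair x1 y1" "x1 $ r $ a \<noteq> 0"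
    using perturb_row_entry[OF assms(1-3)] by blast
  have "open {p :: (quat ^ 'a ^ 'a) \<times> (quat ^ 'a ^ 'a). fst p $ r $ a \<noteq> 0}"
    by (intro open_Collect_neq continuous_intros)
  then have "open (W \<inter> {p. fst p $ r $ a \<noteq> 0})" using assms(1) by blast
  from perturb_col_entry[OF this _ 1(2)] 1 obtain x2 y2 where 2: "(x2, y2) \<in> W" "inverse_pair x2 y2"
    "x2 $ r $ a \<noteq> 0" "y2 $ b $ s \<noteq> 0" by force
  show ?thesis
  proof (cases "(\<Sum>i\<in>J. x2 $ r $ i * y2 $ i $ s) = 0")
    case True
    obtain \<tau> where \<tau>: "\<tau> \<noteq> 0" "(x2 ** elem_mat a b (of_real \<tau>), elem_mat a b (- of_real \<tau>) ** y2) \<in> W"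
      using perturb_elem_mat[OF assms(1) 2(1)] by blast
    have "(\<Sum>i\<in>J. (x2 ** elem_mat a b (of_real \<tau>)) $ r $ i * (elem_mat a b (- of_real \<tau>) ** y2) $ i $ s)
        = (\<Sum>i\<in>J. x2 $ r $ i * y2 $ i $ s + (if i = a then x2 $ r $ a * (- of_real \<tau> * y2 $ b $ s) else 0))"
      using ab by (intro sum.cong) (auto simp: mult_elem_mat_nth elem_mat_mult_nth algebra_simps)
    also have "\<dots> = x2 $ r $ a * (- of_real \<tau> * y2 $ b $ s)"
      using ab True by (simp add: sum.distrib)
    also have "\<dots> \<noteq> 0" using 2 \<tau> by simp
    finally have "(\<Sum>i\<in>J. (x2 ** elem_mat a b (of_real \<tau>)) $ r $ i * (elem_mat a b (- of_real \<tau>) ** y2) $ i $ s) \<noteq> 0" .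
    moreover have "a \<noteq> b" using ab by auto
    ultimately show ?thesis using \<tau>(2) inverse_pair_mult[OF 2(2) inverse_pair_elem_mat] by blast
  qed (use 2 in blast)
qed

text \<open>Each nonvanishing condition is open, so the sets can be treated one after another,
  shrinking \<open>W\<close> each time.\<close>

lemma perturb_partial_sums:
  fixes x y :: "quat ^ 'n ^ 'n"
  assumes "finite \<J>" "open W" "(x, y) \<in> W" "inverse_pair x y" "{} \<notin> \<J>" "UNIV \<notin> \<J>"
  shows "\<exists>x' y'. (x', y') \<in> W \<and> inverse_pair x' y' \<and> (\<forall>J\<in>\<J>. (\<Sum>i\<in>J. x' $ r $ i * y' $ i $ s) \<noteq> 0)"
  using assms
proof (induction \<J> arbitrary: W x y rule: finite_induct)
  case (insert J \<J>)
  obtain x1 y1 where 1: "(x1, y1) \<in> W" "inverse_pair x1 y1" "(\<Sum>i\<in>J. x1 $ r $ i * y1 $ i $ s) \<noteq> 0"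
    using perturb_partial_sum[OF insert.prems(1-3), of J r s] insert.prems(4,5) by blast
  define W' where
    "W' = W \<inter> {p :: (quat ^ 'n ^ 'n) \<times> (quat ^ 'n ^ 'n). (\<Sum>i\<in>J. fst p $ r $ i * snd p $ i $ s) \<noteq> 0}"
  have "open W'"
    unfolding W'_def using insert.prems(1) by (intro open_Int open_Collect_neq continuous_intros)
  moreover have "(x1, y1) \<in> W'" using 1 by (simp add: W'_def)
  ultimately obtain x' y' where "(x', y') \<in> W'" "inverse_pair x' y'"
    "\<forall>J\<in>\<J>. (\<Sum>i\<in>J. x' $ r $ i * y' $ i $ s) \<noteq> 0"
    using insert.IH[of W' x1 y1] 1(2) insert.prems(4,5) by blast
  then show ?case by (intro exI[of _ x'] exI[of _ y']) (simp add: W'_def)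
qed blast

section \<open>The semigroup in an eigenbasis\<close>

lemma matrix_mult_nonzeroE:
  assumes "(A ** B) $ i $ j \<noteq> (0::quat)"
  obtains k where "A $ i $ k \<noteq> 0" "B $ k $ j \<noteq> 0"
proof -
  have "\<exists>k. A $ i $ k * B $ k $ j \<noteq> 0"
    using assms sum.neutral[of UNIV "\<lambda>k. A $ i $ k * B $ k $ j"] unfolding matrix_mult_nth by blast
  then show ?thesis using that by auto
qed

text \<open>The powers stay in a compact set, so two of them, with exponents \<open>a < b\<close>,
  are close. Multiplication by the unit \<open>q i ^ a\<close> is isometric, hence
  \<open>q i ^ (b - a)\<close> is close to 1.\<close>

lemma unit_powers_recurrent:
  fixes q :: "'n::finite \<Rightarrow> quat"
  assumes "\<And>i. norm (q i) = 1" "e > 0"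
  shows "\<exists>M\<ge>1. \<forall>i. norm (q i ^ M - 1) < e"
proof -
  define f where "f m = (\<chi> i. q i ^ m)" for m
  have "norm (f m) \<le> real CARD('n)" for m
  proof -
    have "norm (f m) \<le> (\<Sum>i\<in>UNIV. norm (f m $ i))" by (simp add: norm_vec_def L2_set_le_sum)
    then show ?thesis by (simp add: f_def norm_power assms(1))
  qed
  then have "\<forall>m. f m \<in> cball 0 (real CARD('n))" by simp
  then obtain l r where r: "strict_mono r" "(f \<circ> r) \<longlonglongrightarrow> l"
    using compact_cball[unfolded compact_def, rule_format] by blast
  then have "Cauchy (f \<circ> r)" by (simp add: LIMSEQ_imp_Cauchy)
  then obtain N where N: "\<And>m n. m \<ge> N \<Longrightarrow> n \<ge> N \<Longrightarrow> dist (f (r m)) (f (r n)) < e"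
    using \<open>e > 0\<close> unfolding Cauchy_def o_def by blast
  define a b where "a = r N" and "b = r (Suc N)"
  have ab: "a < b" using r(1) by (simp add: a_def b_def strict_mono_def)
  have "norm (q i ^ (b - a) - 1) < e" for i
  proof -
    have "q i ^ b - q i ^ a = q i ^ a * (q i ^ (b - a) - 1)"
      using ab by (simp add: right_diff_distrib flip: power_add)
    then have "norm (q i ^ (b - a) - 1) = norm ((f b - f a) $ i)"
      by (simp add: f_def norm_mult norm_power assms(1))
    also have "\<dots> \<le> norm (f b - f a)" by (rule Finite_Cartesian_Product.norm_nth_le)
    also have "\<dots> < e" using N[of "Suc N" N] by (simp add: a_def b_def dist_norm)
    finally show ?thesis .
  qed
  then show ?thesis using ab by (intro exI[of _ "b - a"]) auto
qed

text \<open>The conjugation scales the norm of the entry at \<open>i\<close>, \<open>j\<close> by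
  the factor \<open>(norm (t i) / norm (t j)) ^ m\<close>.\<close>

lemma conj_diag_mat_power_tendsto:
  fixes L :: "quat ^ 'n ^ 'n"
  assumes "\<And>i. L $ i $ i = 1" "\<And>i j. i \<noteq> j \<Longrightarrow> L $ i $ j \<noteq> 0 \<Longrightarrow> norm (t i) < norm (t j)"
    and t: "\<And>i. t i \<noteq> 0"
  shows "(\<lambda>m. diag_mat (\<lambda>i. t i ^ m) ** L ** diag_mat (\<lambda>i. inverse (t i) ^ m)) \<longlonglongrightarrow> mat 1"
proof (intro vec_tendstoI)
  fix i j
  have e: "(diag_mat (\<lambda>i. t i ^ m) ** L ** diag_mat (\<lambda>i. inverse (t i) ^ m)) $ i $ j
      = t i ^ m * L $ i $ j * inverse (t j) ^ m" for m
    by (simp add: mult_diag_mat_nth diag_mat_mult_nth)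
  show "(\<lambda>m. (diag_mat (\<lambda>i. t i ^ m) ** L ** diag_mat (\<lambda>i. inverse (t i) ^ m)) $ i $ j) \<longlonglongrightarrow> mat 1 $ i $ j"
  proof (cases "i = j \<or> L $ i $ j = 0")
    case True
    then have "t i ^ m * L $ i $ j * inverse (t j) ^ m = mat 1 $ i $ j" for m
      using assms(1) t by (auto simp: mat_def power_inverse)
    then show ?thesis by (simp add: e)
  next
    case False
    then have lt: "norm (t i) < norm (t j)" using assms(2) by blast
    have "(\<lambda>m. norm (L $ i $ j) * (norm (t i) / norm (t j)) ^ m) \<longlonglongrightarrow> norm (L $ i $ j) * 0"
      using lt t[of j] by (intro tendsto_mult tendsto_const LIMSEQ_realpow_zero) auto
    moreover have "norm (t i ^ m * L $ i $ j * inverse (t j) ^ m)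
        = norm (L $ i $ j) * (norm (t i) / norm (t j)) ^ m" for m
      by (simp add: norm_mult norm_power norm_inverse divide_inverse power_mult_distrib)
    ultimately have "(\<lambda>m. norm (t i ^ m * L $ i $ j * inverse (t j) ^ m)) \<longlonglongrightarrow> 0" by simp
    then have "(\<lambda>m. t i ^ m * L $ i $ j * inverse (t j) ^ m) \<longlonglongrightarrow> 0"
      by (rule tendsto_norm_zero_cancel)
    then show ?thesis using False by (simp add: e mat_def)
  qed
qed

lemma mat_pow_commute: "A ** mat_pow A k = mat_pow A k ** A"
  by (induction k) (simp_all add: matrix_mul_assoc)

lemma mat_pow_diag_mat: "mat_pow (diag_mat q) k = diag_mat (\<lambda>i. q i ^ k)"
  by (induction k) (simp_all add: diag_mat_mult_diag_mat diag_mat_one)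

text \<open>Only the last of the \<open>k\<close> factors absorbs \<open>X\<close>; the others are
  \<open>w\<close> itself, which lies in \<open>S\<close> by the case \<open>X = mat 1\<close>. In
  the applications \<open>P\<close> describes a neighbourhood of the identity.\<close>

lemma mat_pow_mem_near:
  assumes mult: "\<And>g h. g \<in> S \<Longrightarrow> h \<in> S \<Longrightarrow> g ** h \<in> S"
    and "P (mat 1)" and w: "\<And>X. P X \<Longrightarrow> w ** X \<in> S" and "P X" "k \<ge> 1"
  shows "mat_pow w k ** X \<in> S"
  using \<open>k \<ge> 1\<close>
proof (induction k rule: dec_induct)
  case base
  then show ?case using w[OF \<open>P X\<close>] by simp
next
  case (step k)
  have "w \<in> S" using w[OF \<open>P (mat 1)\<close>] by simp
  from mult[OF this step.IH] show ?case by (simp add: matrix_mul_assoc)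
qed

text \<open>Here \<open>S\<close> is written in an eigenbasis of one of its interior points, which becomes \<open>diag_mat t\<close>.
  The matrices \<open>1 + v c \<phi>\<close> form the image of the root subgroup \<open>1 + c E\<^sub>s\<^sub>r\<close> of \<open>Sl(2, \<bbbH>)\<^sub>r\<^sub>,\<^sub>s\<close>, the only
  part of that group which the proof uses.\<close>

locale semigroup_in_eigenbasis =
  fixes S :: "(quat ^ 'n ^ 'n) set" and t v \<phi> :: "'n \<Rightarrow> quat" and \<epsilon> :: real
  assumes det_S: "g \<in> S \<Longrightarrow> real_det g = 1"
    and mult_S: "g \<in> S \<Longrightarrow> h \<in> S \<Longrightarrow> g ** h \<in> S"
    and eps: "\<epsilon> > 0"
    and near: "real_det X = 1 \<Longrightarrow> norm (X - mat 1) < \<epsilon> \<Longrightarrow> diag_mat t ** X \<in> S \<and> X ** diag_mat t \<in> S"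
    and transvection: "mat 1 + (\<chi> i j. v i * c * \<phi> j) \<in> S"
    and norm_t: "inj (\<lambda>i. norm (t i))" and t_nonzero: "t i \<noteq> 0"
    and partial: "J \<noteq> {} \<Longrightarrow> J \<noteq> UNIV \<Longrightarrow> (\<Sum>i\<in>J. \<phi> i * v i) \<noteq> 0"
    and total: "(\<Sum>i\<in>UNIV. \<phi> i * v i) = 0"
begin

section \<open>Order of the eigenvalues and absorption of unipotent factors\<close>

text \<open>Position by decreasing absolute value, counted from 0 for the largest eigenvalue. Upper
  and lower triangular refer to this order.\<close>

definition rk :: "'n \<Rightarrow> nat" where
  "rk i = card {j. norm (t j) > norm (t i)}"

lemma rk_less_if: "norm (t j) < norm (t i) \<Longrightarrow> rk i < rk j"
  unfolding rk_def by (rule psubset_card_mono) auto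

lemma rk_less_iff: "rk i < rk j \<longleftrightarrow> norm (t j) < norm (t i)"
  using rk_less_if[of i j] rk_less_if[of j i] norm_t
  by (metis injD less_irrefl_nat linorder_neqE_linordered_idom not_less_iff_gr_or_eq)

lemma inj_rk: "inj rk"
  by (rule injI) (metis injD less_irrefl linorder_neqE_linordered_idom norm_t rk_less_iff)

lemma rk_eq_iff [simp]: "rk i = rk j \<longleftrightarrow> i = j"
  using inj_rk by (auto dest: injD)

lemma range_rk: "range rk = {..<CARD('n)}"
proof (rule card_subset_eq)
  show "range rk \<subseteq> {..<CARD('n)}"
  proof clarsimp
    show "rk i < CARD('n)" for i
      unfolding rk_def by (rule psubset_card_mono) auto
  qed
qed (simp_all add: card_image inj_rk)

lemma exists_rk: "k < CARD('n) \<Longrightarrow> \<exists>i. rk i = k"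
  using range_rk by (metis imageE lessThan_iff)

lemma diag_mat_power_conj: "inverse_pair (diag_mat (\<lambda>i. t i ^ m)) (diag_mat (\<lambda>i. inverse (t i) ^ m))"
  using t_nonzero by (simp add: inverse_pair_def diag_mat_mult_diag_mat power_inverse diag_mat_one)

lemma diag_mat_power_mem: "m \<ge> 1 \<Longrightarrow> diag_mat (\<lambda>i. t i ^ m) \<in> S"
proof (induction m rule: dec_induct)
  case base
  show ?case using near[of "mat 1"] eps by simp
next
  case (step m)
  have "diag_mat t \<in> S" using near[of "mat 1"] eps by simp
  from mult_S[OF this step.IH] show ?case by (simp add: diag_mat_mult_diag_mat)
qed

text \<open>Conjugation by powers of \<open>diag_mat t\<close> contracts \<open>L\<close> and \<open>u\<close> to the identity, so that they are absorbed
  by the neighbourhood of \<open>diag_mat t\<close> contained in \<open>S\<close>.\<close>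

lemma absorb_unipotent:
  assumes L: "\<And>i. L $ i $ i = 1" "\<And>i j. i \<noteq> j \<Longrightarrow> L $ i $ j \<noteq> 0 \<Longrightarrow> rk j < rk i"
    and u: "\<And>i. u $ i $ i = 1" "\<And>i j. i \<noteq> j \<Longrightarrow> u $ i $ j \<noteq> 0 \<Longrightarrow> rk i < rk j"
    and h: "h \<in> S"
  shows "\<exists>m. diag_mat (\<lambda>i. t i ^ m) ** (L ** h ** u) ** diag_mat (\<lambda>i. t i ^ m) \<in> S"
proof -
  define P where "P m = diag_mat (\<lambda>i. t i ^ m)" for m
  define P' where "P' m = diag_mat (\<lambda>i. inverse (t i) ^ m)" for m
  have PP: "inverse_pair (P m) (P' m)" for m unfolding P_def P'_def by (rule diag_mat_power_conj)
  have lim: "(\<lambda>m. P m ** L ** P' m) \<longlonglongrightarrow> mat 1"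
    unfolding P_def P'_def using L t_nonzero by (intro conj_diag_mat_power_tendsto) (auto simp: rk_less_iff)
  \<comment> \<open>For \<open>u\<close> the order is reversed, so the inverse eigenvalues give the
    contracting conjugation.\<close>
  have "(\<lambda>m. diag_mat (\<lambda>i. inverse (t i) ^ m) ** u ** diag_mat (\<lambda>i. inverse (inverse (t i)) ^ m)) \<longlonglongrightarrow> mat 1"
    using u t_nonzero by (intro conj_diag_mat_power_tendsto) (auto simp: rk_less_iff norm_inverse)
  then have lim': "(\<lambda>m. P' m ** u ** P m) \<longlonglongrightarrow> mat 1"
    by (simp add: P_def P'_def)
  \<comment> \<open>Conjugation does not change the determinant, so these sequences are constant and
    equal to their limit 1.\<close>
  have "(\<lambda>m. real_det (P m ** L ** P' m)) \<longlonglongrightarrow> 1" "(\<lambda>m. real_det (P' m ** u ** P m)) \<longlonglongrightarrow> 1"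
    using tendsto_real_det[OF lim] tendsto_real_det[OF lim'] by auto
  then have det: "real_det L = 1" "real_det u = 1"
    by (simp_all add: real_det_conj[OF PP] real_det_conj[OF inverse_pair_sym[OF PP]] LIMSEQ_const_iff)
  have "\<forall>\<^sub>F m in sequentially. norm (P m ** L ** P' m - mat 1) < \<epsilon> \<and> norm (P' m ** u ** P m - mat 1) < \<epsilon> \<and> m \<ge> 1"
    using tendstoD[OF lim eps] tendstoD[OF lim' eps]
    by (intro eventually_conj eventually_ge_at_top) (simp_all add: dist_norm)
  then obtain m where m: "norm (P m ** L ** P' m - mat 1) < \<epsilon>" "norm (P' m ** u ** P m - mat 1) < \<epsilon>" "m \<ge> 1"
    by (metis (no_types, lifting) eventually_sequentially order_refl)
  have a: "diag_mat t ** (P m ** L ** P' m) \<in> S" and b: "(P' m ** u ** P m) ** diag_mat t \<in> S"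
    using near[OF _ m(1)] near[OF _ m(2)]
    by (simp_all add: det real_det_conj[OF PP] real_det_conj[OF inverse_pair_sym[OF PP]])
  have P: "P m \<in> S" unfolding P_def by (rule diag_mat_power_mem[OF m(3)])
  \<comment> \<open>The factors \<open>P m\<close> around \<open>h\<close> cancel the adjacent
    \<open>P' m\<close>, which leaves \<open>L ** h ** u\<close> between two diagonal
    powers.\<close>
  have "diag_mat t ** (P m ** L ** P' m) ** P m ** h ** P m ** ((P' m ** u ** P m) ** diag_mat t) \<in> S"
    by (rule mult_S[OF mult_S[OF mult_S[OF mult_S[OF a P] h] P] b])
  moreover have "diag_mat t ** (P m ** L ** P' m) ** P m ** h ** P m ** ((P' m ** u ** P m) ** diag_mat t)
      = diag_mat t ** (P m ** (L ** (P' m ** (P m ** (h ** (P m ** (P' m ** (u ** (P m ** diag_mat t)))))))))"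
    by (simp add: matrix_mul_assoc)
  moreover have "\<dots> = (diag_mat t ** P m) ** (L ** h ** u) ** (P m ** diag_mat t)"
    by (simp only: inverse_pair_cancel[OF PP]) (simp only: matrix_mul_assoc)
  moreover have "diag_mat t ** P m = diag_mat (\<lambda>i. t i ^ Suc m)" "P m ** diag_mat t = diag_mat (\<lambda>i. t i ^ Suc m)"
    by (simp_all add: P_def diag_mat_mult_diag_mat power_commutes)
  ultimately show ?thesis by metis
qed

text \<open>The element \<open>h\<close> below has all its leading principal blocks with respect to \<open>rk\<close> invertible except
  the one of size \<open>k + 1\<close>; it therefore lies in the Bruhat cell of the transposition of \<open>k\<close> and \<open>k + 1\<close>,
  and \<open>L ** h ** u'\<close> is the corresponding monomial matrix.\<close>

lemma exists_transposition:
  assumes k: "Suc k < CARD('n)"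
  shows "\<exists>g\<in>S. \<forall>i j. g $ i $ j \<noteq> 0 \<longrightarrow>
    rk i = (if rk j = k then Suc k else if rk j = Suc k then k else rk j)"
proof -
  obtain p q where pq: "rk p = k" "rk q = Suc k"
    using exists_rk[of k] exists_rk[of "Suc k"] k by auto
  define B0 where "B0 m = (\<Sum>l | rk l < m. \<phi> l * v l)" for m
  have "B0 (Suc k) \<noteq> 0"
    unfolding B0_def
  proof (rule partial)
    have "p \<in> {l. rk l < Suc k}" "q \<notin> {l. rk l < Suc k}" using pq by auto
    then show "{l. rk l < Suc k} \<noteq> {}" "{l. rk l < Suc k} \<noteq> UNIV" by blast+
  qed
  \<comment> \<open>The leading block of size \<open>m\<close> of \<open>h\<close> is a rank-one
    perturbation of the identity, invertible exactly if \<open>1 + B m\<close> is nonzero. This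
    \<open>c\<close> makes \<open>1 + B (Suc k)\<close> vanish.\<close>
  define c where "c = - inverse (B0 (Suc k))"
  have c: "c \<noteq> 0" using \<open>B0 (Suc k) \<noteq> 0\<close> by (simp add: c_def)
  define \<psi> where "\<psi> l = c * \<phi> l" for l
  define B where "B m = (\<Sum>l | rk l < m. \<psi> l * v l)" for m
  have B: "B m = c * B0 m" for m by (simp add: B_def B0_def \<psi>_def sum_distrib_left mult.assoc)
  have BSuc: "B (Suc k) = -1" using \<open>B0 (Suc k) \<noteq> 0\<close> by (simp add: B c_def)
  have Bk: "B (Suc k) = B k + \<psi> p * v p"
  proof -
    have "{l. rk l < Suc k} = insert p {l. rk l < k}"
      using pq(1) by (auto simp: less_Suc_eq)
    then show ?thesis using pq(1) by (simp add: B_def add.commute)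
  qed
  have nz: "\<phi> i \<noteq> 0" "v i \<noteq> 0" for i
  proof -
    have "{i} \<noteq> UNIV" using pq by (metis UNIV_I n_not_Suc_n singletonD)
    from partial[OF _ this] show "\<phi> i \<noteq> 0" "v i \<noteq> 0" by auto
  qed
  \<comment> \<open>Another vanishing block would give \<open>B0 m = B0 (Suc k)\<close>. The partial
    sum over the ranks between \<open>m\<close> and \<open>Suc k\<close> would then be zero,
    although that index set is nonempty and proper.\<close>
  have A: "1 + B m \<noteq> 0" if m: "m \<noteq> Suc k" "m < CARD('n)" for m
  proof
    assume "1 + B m = 0"
    then have "c * B0 m = c * B0 (Suc k)" using BSuc by (simp add: B add_eq_0_iff)
    then have e: "B0 m = B0 (Suc k)" using c by simp
    obtain r where r: "rk r = m" using exists_rk[OF m(2)] by blast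
    obtain o0 where o0: "rk o0 = 0" using exists_rk[of 0] k by auto
    have split: "B0 b = B0 a + (\<Sum>l | a \<le> rk l \<and> rk l < b. \<phi> l * v l)" if "a \<le> b" for a b
    proof -
      have "{l. rk l < b} = {l. rk l < a} \<union> {l. a \<le> rk l \<and> rk l < b}" using that by auto
      then show ?thesis unfolding B0_def by (simp add: sum.union_disjoint[symmetric] disjoint_iff)
    qed
    show False
    proof (cases "m < Suc k")
      case True
      then have "(\<Sum>l | m \<le> rk l \<and> rk l < Suc k. \<phi> l * v l) = 0" using split[of m "Suc k"] e by simp
      moreover have "r \<in> {l. m \<le> rk l \<and> rk l < Suc k}" "q \<notin> {l. m \<le> rk l \<and> rk l < Suc k}"
        using r True pq by auto
      ultimately show False using partial by (metis UNIV_I empty_iff)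
    next
      case False
      then have "(\<Sum>l | Suc k \<le> rk l \<and> rk l < m. \<phi> l * v l) = 0" using split[of "Suc k" m] e by simp
      moreover have "q \<in> {l. Suc k \<le> rk l \<and> rk l < m}" "o0 \<notin> {l. Suc k \<le> rk l \<and> rk l < m}"
        using o0 False m(1) pq by auto
      ultimately show False using partial by (metis UNIV_I empty_iff)
    qed
  qed
  \<comment> \<open>Size of the invertible leading block used to eliminate with index
    \<open>j\<close>: its own rank, except that \<open>q\<close> falls back to size \<open>k\<close>
    because the block of size \<open>Suc k\<close> is singular.\<close>
  define \<sigma> where "\<sigma> j = (if j = q then k else rk j)" for j
  define \<beta> where "\<beta> j = inverse (1 + B (\<sigma> j))" for j
  have \<sigma>: "\<sigma> j \<le> rk j" "\<sigma> p = k" "\<sigma> q = k" for j using pq by (auto simp: \<sigma>_def)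
  have \<sigma>_ne: "\<sigma> j \<noteq> Suc k" for j using pq by (auto simp: \<sigma>_def simp flip: rk_eq_iff)
  have rk_bound: "rk j < CARD('n)" for j using range_rk by auto
  have "1 + B (\<sigma> j) \<noteq> 0" for j
    using A[OF \<sigma>_ne] le_less_trans[OF \<sigma>(1) rk_bound] by blast
  then have \<beta>: "(1 + B (\<sigma> j)) * \<beta> j = 1" "\<beta> j * (1 + B (\<sigma> j)) = 1" "\<beta> j \<noteq> 0" for j
    by (simp_all add: \<beta>_def)
  define h where "h = mat 1 + (\<chi> i j. v i * c * \<phi> j)"
  have h: "h \<in> S" unfolding h_def by (rule transvection)
  have h_nth: "h $ i $ j = (if i = j then 1 else 0) + v i * \<psi> j" for i j
    by (simp add: h_def \<psi>_def mat_def mult.assoc)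
  \<comment> \<open>The Sherman-Morrison formula for the leading block of size
    \<open>\<sigma> j\<close>: column \<open>j\<close> of \<open>h ** u\<close> vanishes in all
    ranks below \<open>\<sigma> j\<close>. The matrix \<open>L\<close> does the same for
    rows.\<close>
  define u where "u = (\<chi> i j. (if i = j then 1 else 0) - (if rk i < \<sigma> j then v i * \<beta> j * \<psi> j else 0))"
  have u_nth: "u $ i $ j = (if i = j then 1 else 0) - (if rk i < \<sigma> j then v i * \<beta> j * \<psi> j else 0)" for i j
    by (simp add: u_def)
  define L where "L = (\<chi> i j. (if i = j then 1 else 0) - (if rk j < \<sigma> i then v i * \<beta> i * \<psi> j else 0))"
  have L_nth: "L $ i $ j = (if i = j then 1 else 0) - (if rk j < \<sigma> i then v i * \<beta> i * \<psi> j else 0)" for i j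
    by (simp add: L_def)
  have hu: "(h ** u) $ i $ j = (if i = j then 1 else 0) + (if rk i < \<sigma> j then 0 else v i * \<beta> j * \<psi> j)" for i j
  proof -
    have "(\<Sum>l\<in>UNIV. \<psi> l * u $ l $ j)
        = (\<Sum>l\<in>UNIV. (if l = j then \<psi> j else 0) - (if rk l < \<sigma> j then \<psi> l * v l * (\<beta> j * \<psi> j) else 0))"
      by (rule sum.cong) (auto simp: u_nth algebra_simps)
    also have "\<dots> = \<psi> j - B (\<sigma> j) * (\<beta> j * \<psi> j)"
      by (simp add: sum_subtractf sum_distrib_right B_def sum.If_cases)
    also have "\<dots> = ((1 + B (\<sigma> j)) * \<beta> j - B (\<sigma> j) * \<beta> j) * \<psi> j"
      unfolding \<beta>(1) by (simp add: algebra_simps)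
    also have "\<dots> = \<beta> j * \<psi> j" by (simp add: algebra_simps)
    finally have 1: "(\<Sum>l\<in>UNIV. \<psi> l * u $ l $ j) = \<beta> j * \<psi> j" .
    have "(h ** u) $ i $ j = (\<Sum>l\<in>UNIV. (if l = i then u $ i $ j else 0) + v i * (\<psi> l * u $ l $ j))"
      unfolding matrix_mult_nth by (rule sum.cong) (auto simp: h_nth algebra_simps)
    also have "\<dots> = u $ i $ j + v i * (\<beta> j * \<psi> j)"
      by (simp add: sum.distrib 1 flip: sum_distrib_left)
    finally show ?thesis by (simp add: u_nth mult.assoc)
  qed
  have Lh: "(L ** h) $ i $ j = (if i = j then 1 else 0) + (if rk j < \<sigma> i then 0 else v i * \<beta> i * \<psi> j)" for i j
  proof -
    have "(\<Sum>l\<in>UNIV. L $ i $ l * v l)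
        = (\<Sum>l\<in>UNIV. (if l = i then v i else 0) - (if rk l < \<sigma> i then v i * \<beta> i * (\<psi> l * v l) else 0))"
      by (rule sum.cong) (auto simp: L_nth algebra_simps)
    also have "\<dots> = v i - v i * \<beta> i * B (\<sigma> i)"
      by (simp add: sum_subtractf sum_distrib_left B_def sum.If_cases)
    also have "\<dots> = v i * (\<beta> i * (1 + B (\<sigma> i)) - \<beta> i * B (\<sigma> i))"
      unfolding \<beta>(2) by (simp add: algebra_simps)
    also have "\<dots> = v i * \<beta> i" by (simp add: algebra_simps)
    finally have 1: "(\<Sum>l\<in>UNIV. L $ i $ l * v l) = v i * \<beta> i" .
    have "(L ** h) $ i $ j = (\<Sum>l\<in>UNIV. (if l = j then L $ i $ j else 0) + (L $ i $ l * v l) * \<psi> j)"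
      unfolding matrix_mult_nth by (rule sum.cong) (auto simp: h_nth algebra_simps)
    also have "\<dots> = L $ i $ j + v i * \<beta> i * \<psi> j"
      by (simp add: sum.distrib 1 flip: sum_distrib_right)
    finally show ?thesis by (simp add: L_nth)
  qed
  define G where "G = L ** h ** u"
  \<comment> \<open>Together with \<open>G0'\<close> this makes \<open>G\<close> diagonal outside
    the block of \<open>p\<close> and \<open>q\<close>.\<close>
  have G0: "G $ i $ j = 0" if "rk i < \<sigma> j" for i j
  proof (rule ccontr)
    assume "G $ i $ j \<noteq> 0"
    then obtain l where l: "L $ i $ l \<noteq> 0" "(h ** u) $ l $ j \<noteq> 0"
      unfolding G_def matrix_mul_assoc[symmetric] by (rule matrix_mult_nonzeroE)
    have "rk l \<le> rk i" using l(1) \<sigma>(1)[of i] by (auto simp: L_nth split: if_splits)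
    with that \<sigma>(1)[of j] have "rk l < \<sigma> j" "l \<noteq> j" by auto
    with l(2) show False by (simp add: hu)
  qed
  have G0': "G $ i $ j = 0" if "rk j < \<sigma> i" for i j
  proof (rule ccontr)
    assume "G $ i $ j \<noteq> 0"
    then obtain l where l: "(L ** h) $ i $ l \<noteq> 0" "u $ l $ j \<noteq> 0"
      unfolding G_def by (rule matrix_mult_nonzeroE)
    have "rk l \<le> rk j" using l(2) \<sigma>(1)[of j] by (auto simp: u_nth split: if_splits)
    with that \<sigma>(1)[of i] have "rk l < \<sigma> i" "l \<noteq> i" by auto
    with l(1) show False by (simp add: Lh)
  qed
  \<comment> \<open>Off its diagonal, this row of \<open>L\<close> only meets ranks below
    \<open>k\<close>, where column \<open>p\<close> of \<open>h ** u\<close> is zero.\<close>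
  have G1: "G $ i $ p = (h ** u) $ i $ p" if "\<sigma> i = k" for i
  proof -
    have "G $ i $ p = (\<Sum>l\<in>UNIV. if l = i then (h ** u) $ i $ p else 0)"
      unfolding G_def matrix_mul_assoc[symmetric] matrix_mult_nth[of L]
    proof (rule sum.cong)
      show "L $ i $ l * (h ** u) $ l $ p = (if l = i then (h ** u) $ i $ p else 0)" for l
        using that pq(1) \<sigma>(1)[of i] \<sigma>(2) by (auto simp: L_nth hu)
    qed simp
    then show ?thesis by simp
  qed
  \<comment> \<open>This is where the singular block enters: \<open>1 + B (Suc k) = 0\<close> says
    that \<open>\<psi> p * v p = - (1 + B k)\<close>.\<close>
  have Gpp: "G $ p $ p = 0"
  proof -
    have "\<psi> p * v p = - (1 + B k)" using Bk BSuc by (simp add: algebra_simps)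
    then have "\<psi> p * (v p * \<beta> p * \<psi> p) = - (1 + B k) * \<beta> p * \<psi> p" by (simp only: mult.assoc[symmetric])
    also have "\<dots> = - \<psi> p" using \<beta>(1)[of p] \<sigma>(2) by (simp only: mult_minus_left) simp
    finally have "\<psi> p * (1 + v p * \<beta> p * \<psi> p) = 0" by (simp add: distrib_left)
    then have "1 + v p * \<beta> p * \<psi> p = 0" using nz c by (simp add: \<psi>_def)
    then show ?thesis using G1[OF \<sigma>(2)] \<sigma>(2) pq by (simp add: hu)
  qed
  have Gqp: "G $ q $ p \<noteq> 0"
  proof -
    have "q \<noteq> p" using pq by auto
    then show ?thesis using G1[OF \<sigma>(3)] \<sigma>(2) pq nz c \<beta>(3) by (simp add: hu \<psi>_def)
  qed
  \<comment> \<open>Subtracting column \<open>p\<close> times \<open>f\<close> from column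
    \<open>q\<close> clears the entry at \<open>q\<close>, \<open>q\<close>. The operation is upper
    unipotent because \<open>p\<close> precedes \<open>q\<close> in rank.\<close>
  define f where "f = inverse (G $ q $ p) * G $ q $ q"
  define u' where "u' = u ** elem_mat p q (- f)"
  have G': "(L ** h ** u') $ i $ j = G $ i $ j - (if j = q then G $ i $ p * f else 0)" for i j
    unfolding u'_def G_def by (simp add: matrix_mul_assoc mult_elem_mat_nth)
  have pattern: "rk i = (if rk j = k then Suc k else if rk j = Suc k then k else rk j)"
    if ne: "(L ** h ** u') $ i $ j \<noteq> 0" for i j
  proof -
    have Gij: "\<sigma> j \<le> rk i \<and> \<sigma> i \<le> rk j" if "G $ i $ j \<noteq> 0" for i j
      using G0[of i j] G0'[of j i] that by (meson not_less)
    have ip: "i = q" if "G $ i $ p \<noteq> 0" for i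
    proof -
      have "i \<noteq> p" using that Gpp by auto
      then show ?thesis using Gij[OF that] pq \<sigma>(2) by (auto simp: \<sigma>_def simp flip: rk_eq_iff split: if_splits)
    qed
    consider "j = p" | "j = q" | "j \<noteq> p" "j \<noteq> q" by blast
    then show ?thesis
    proof cases
      case 1
      moreover have "p \<noteq> q" using pq by auto
      ultimately have "G $ i $ p \<noteq> 0" using ne by (simp add: G')
      then show ?thesis using ip pq 1 by simp
    next
      case 2
      have "i = p"
      proof (rule ccontr)
        assume "i \<noteq> p"
        show False
        proof (cases "i = q")
          case True
          then show False using ne 2 Gqp by (simp add: G' f_def mult.assoc[symmetric])
        next
          case False
          then have "G $ i $ p = 0" using ip by blast
          then have "G $ i $ q \<noteq> 0" using ne 2 by (simp add: G')
          from Gij[OF this] show False using False \<open>i \<noteq> p\<close> pq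
            by (auto simp: \<sigma>_def le_Suc_eq simp flip: rk_eq_iff split: if_splits)
        qed
      qed
      then show ?thesis using 2 pq by simp
    next
      case 3
      then have "G $ i $ j \<noteq> 0" using ne by (simp add: G')
      from Gij[OF this] have "rk j = rk i" using 3 pq
        by (auto simp: \<sigma>_def le_Suc_eq simp flip: rk_eq_iff split: if_splits)
      then show ?thesis using 3 pq by (auto simp flip: rk_eq_iff)
    qed
  qed
  have "\<exists>m. diag_mat (\<lambda>i. t i ^ m) ** (L ** h ** u') ** diag_mat (\<lambda>i. t i ^ m) \<in> S"
  proof (rule absorb_unipotent[OF _ _ _ _ h])
    show "L $ i $ i = 1" for i using \<sigma>(1)[of i] by (simp add: L_nth)
    show "rk j < rk i" if "i \<noteq> j" "L $ i $ j \<noteq> 0" for i j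
      using that \<sigma>(1)[of i] by (auto simp: L_nth split: if_splits)
    have qp: "u $ q $ p = 0" using pq \<sigma>(2) by (auto simp: u_nth)
    show "u' $ i $ i = 1" for i using \<sigma>(1)[of i] qp by (auto simp: u'_def mult_elem_mat_nth u_nth)
    show "rk i < rk j" if "i \<noteq> j" "u' $ i $ j \<noteq> 0" for i j
    proof (cases "u $ i $ j = 0")
      case True
      then have "j = q" "u $ i $ p \<noteq> 0" using that by (auto simp: u'_def mult_elem_mat_nth split: if_splits)
      then show ?thesis using pq \<sigma>(2) by (auto simp: u_nth split: if_splits)
    next
      case False
      then show ?thesis using that(1) \<sigma>(1)[of j] by (auto simp: u_nth split: if_splits)
    qed
  qed
  then obtain m where m: "diag_mat (\<lambda>i. t i ^ m) ** (L ** h ** u') ** diag_mat (\<lambda>i. t i ^ m) \<in> S" by blast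
  then show ?thesis
    by (intro bexI[OF _ m] allI impI pattern) (auto simp: mult_diag_mat_nth diag_mat_mult_nth)
qed

section \<open>From transpositions to a neighbourhood of the identity\<close>

text \<open>Transpositions of adjacent ranks are multiplied on from the left. Starting from
  \<open>diag_mat t\<close> provides a neighbourhood of \<open>y\<close> inside \<open>S\<close>,
  and left multiplication by elements of \<open>S\<close> preserves this property.\<close>

lemma exists_partial_cycle:
  assumes "k < CARD('n)"
  shows "\<exists>y. (\<forall>X. real_det X = 1 \<longrightarrow> norm (X - mat 1) < \<epsilon> \<longrightarrow> y ** X \<in> S) \<and>
    (\<forall>i j. y $ i $ j \<noteq> 0 \<longrightarrow>
      rk i = (if rk j = 0 then k else if rk j \<le> k then rk j - 1 else rk j))"
  using assms
proof (induction k)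
  case 0
  show ?case using near by (intro exI[of _ "diag_mat t"]) (auto simp: diag_mat_nth)
next
  case (Suc k)
  then obtain y where y: "\<And>X. real_det X = 1 \<Longrightarrow> norm (X - mat 1) < \<epsilon> \<Longrightarrow> y ** X \<in> S"
    "\<And>i j. y $ i $ j \<noteq> 0 \<Longrightarrow> rk i = (if rk j = 0 then k else if rk j \<le> k then rk j - 1 else rk j)"
    by (meson Suc_lessD)
  obtain g where g: "g \<in> S" "\<And>i j. g $ i $ j \<noteq> 0 \<Longrightarrow>
      rk i = (if rk j = k then Suc k else if rk j = Suc k then k else rk j)"
    using exists_transposition[OF Suc.prems] by blast
  have "(g ** y) ** X \<in> S" if "real_det X = 1" "norm (X - mat 1) < \<epsilon>" for X
    using mult_S[OF g(1) y(1)[OF that]] by (simp add: matrix_mul_assoc)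
  moreover have "rk i = (if rk j = 0 then Suc k else if rk j \<le> Suc k then rk j - 1 else rk j)"
    if "(g ** y) $ i $ j \<noteq> 0" for i j
    using that
  proof (rule matrix_mult_nonzeroE)
    fix l assume "g $ i $ l \<noteq> 0" "y $ l $ j \<noteq> 0"
    from g(2)[OF this(1)] y(2)[OF this(2)] show ?thesis
      by (auto split: if_splits)
  qed
  ultimately show ?case by blast
qed

text \<open>The power \<open>w\<close> with exponent \<open>n\<close> of the monomial cycle
  \<open>z\<close> is diagonal. It commutes with \<open>z\<close>, so all its entries have one
  common norm, which the determinant forces to be 1.\<close>

lemma exists_unit_diagonal:
  "\<exists>q. (\<forall>X. real_det X = 1 \<longrightarrow> norm (X - mat 1) < \<epsilon> \<longrightarrow> diag_mat q ** X \<in> S) \<and> (\<forall>i. norm (q i) = 1)"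
proof -
  define n where "n = CARD('n)"
  have n: "n > 0" by (simp add: n_def)
  define \<pi> where "\<pi> j = (if j = 0 then n - 1 else j - 1)" for j :: nat
  obtain z where z: "\<And>X. real_det X = 1 \<Longrightarrow> norm (X - mat 1) < \<epsilon> \<Longrightarrow> z ** X \<in> S"
    "\<And>i j. z $ i $ j \<noteq> 0 \<Longrightarrow>
      rk i = (if rk j = 0 then n - 1 else if rk j \<le> n - 1 then rk j - 1 else rk j)"
    using exists_partial_cycle[of "n - 1"] n by (auto simp: n_def)
  have rk_bound: "rk j < n" for j using range_rk by (auto simp: n_def)
  have z\<pi>: "rk i = \<pi> (rk j)" if "z $ i $ j \<noteq> 0" for i j
    using z(2)[OF that] rk_bound[of j] by (auto simp: \<pi>_def)
  have pow: "rk i = (\<pi> ^^ k) (rk j)" if "mat_pow z k $ i $ j \<noteq> 0" for k i j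
    using that
  proof (induction k arbitrary: i)
    case 0
    then show ?case by (simp add: mat_def split: if_splits)
  next
    case (Suc k)
    from Suc.prems have "(z ** mat_pow z k) $ i $ j \<noteq> 0" by simp
    then show ?case
    proof (rule matrix_mult_nonzeroE)
      fix l assume "z $ i $ l \<noteq> 0" "mat_pow z k $ l $ j \<noteq> 0"
      then show ?thesis using z\<pi>[of i l] Suc.IH[of l] by simp
    qed
  qed
  \<comment> \<open>Each step lowers the rank by one and wraps from 0 to \<open>n - 1\<close>, so
    \<open>n\<close> steps return to the start.\<close>
  have "(\<pi> ^^ i) j = (if i \<le> j then j - i else j + n - i)" if "j < n" "i \<le> n" for i j
    using that(2)
  proof (induction i)
    case (Suc i)
    then show ?case using that(1) by (auto simp: \<pi>_def)
  qed simp
  then have \<pi>n: "(\<pi> ^^ n) (rk j) = rk j" for j using rk_bound[of j] by simp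
  define w where "w = mat_pow z n"
  define q where "q i = w $ i $ i" for i
  have w: "w = diag_mat q"
  proof -
    have "w $ i $ j = diag_mat q $ i $ j" for i j
      using pow[of n i j] \<pi>n[of j] by (auto simp: diag_mat_nth q_def w_def)
    then show ?thesis by (simp add: vec_eq_iff)
  qed
  have wX: "w ** X \<in> S" if "real_det X = 1" "norm (X - mat 1) < \<epsilon>" for X
    unfolding w_def using that z(1) eps n
    by (intro mat_pow_mem_near[where P = "\<lambda>X. real_det X = 1 \<and> norm (X - mat 1) < \<epsilon>"])
      (auto intro: mult_S)
  have detz: "real_det z = 1" using det_S[OF z(1)[of "mat 1"]] eps by simp
  have detw: "real_det w = 1" using det_S[OF wX[of "mat 1"]] eps by simp
  obtain z' where "inverse_pair z z'" using inverse_if_real_det[of z] detz by (auto simp: inverse_pair_def)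
  obtain i0 where i0: "rk i0 = 0" using exists_rk[of 0] by auto
  have "norm (q j) = norm (q i0)" if "rk j = m" for m j
    using that
  proof (induction m arbitrary: j)
    case 0
    then have "j = i0" using i0 by (metis rk_eq_iff)
    then show ?case by simp
  next
    case (Suc m)
    obtain i where i: "z $ i $ j \<noteq> 0" using col_nonzero[OF \<open>inverse_pair z z'\<close>] by blast
    have "rk i = m" using z\<pi>[OF i] Suc.prems by (simp add: \<pi>_def)
    then have IH: "norm (q i) = norm (q i0)" by (rule Suc.IH)
    \<comment> \<open>Comparing entries of \<open>w ** z\<close> and \<open>z ** w\<close> at a
      nonzero entry of \<open>z\<close> equates the norms of \<open>q i\<close> and
      \<open>q j\<close>.\<close>
    have "(w ** z) $ i $ j = (z ** w) $ i $ j"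
      unfolding w_def by (simp add: mat_pow_commute)
    then have "q i * z $ i $ j = z $ i $ j * q j" by (simp add: w diag_mat_mult_nth mult_diag_mat_nth)
    then have "norm (q i) * norm (z $ i $ j) = norm (z $ i $ j) * norm (q j)"
      by (simp flip: norm_mult)
    then show ?case using i IH by simp
  qed
  then have qc: "norm (q j) = norm (q i0)" for j by blast
  define c where "c = norm (q i0)"
  \<comment> \<open>The default 1 keeps every \<open>u i\<close> a unit. A zero \<open>q i\<close>
    would make \<open>c\<close> zero, which the determinant excludes below.\<close>
  define u where "u i = (if q i = 0 then 1 else sgn (q i))" for i
  have u: "norm (u i) = 1" for i by (simp add: u_def norm_sgn)
  have "q i = c *\<^sub>R u i" for i
  proof (cases "q i = 0")
    case True
    then have "c = 0" using qc[of i] by (simp add: c_def)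
    with True show ?thesis by simp
  next
    case False
    then show ?thesis using qc[of i, symmetric] by (simp add: u_def c_def sgn_div_norm)
  qed
  then have "diag_mat q = c *\<^sub>R diag_mat u" by (simp add: vec_eq_iff diag_mat_nth)
  then have "c ^ (n * 4) * real_det (diag_mat u) = 1" using detw by (simp add: w real_det_scaleR n_def)
  then have "\<bar>c ^ (n * 4) * real_det (diag_mat u)\<bar> = 1" by simp
  then have "c ^ (n * 4) = 1"
    by (simp add: abs_mult abs_real_det_unit_diag_mat[OF u] c_def power_abs)
  then have "c = 1" using n power_eq_imp_eq_base[of c "n * 4" 1] by (simp add: c_def)
  then show ?thesis using wX w qc unfolding c_def by (intro exI[of _ q]) auto
qed

text \<open>Powers of a unitary diagonal element of the interior of \<open>S\<close> return to every neighbourhood of the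
  identity, so that the identity is an interior point as well.\<close>

lemma one_interior: "\<exists>\<delta>>0. \<forall>X. real_det X = 1 \<longrightarrow> norm (X - mat 1) < \<delta> \<longrightarrow> X \<in> S"
proof -
  obtain q where q: "\<And>X. real_det X = 1 \<Longrightarrow> norm (X - mat 1) < \<epsilon> \<Longrightarrow> diag_mat q ** X \<in> S"
    "\<And>i. norm (q i) = 1"
    using exists_unit_diagonal by blast
  have qn: "q i \<noteq> 0" for i using q(2)[of i] by auto
  \<comment> \<open>The bound is summed over the \<open>CARD('n)\<close> diagonal entries and gives
    distance less than \<open>\<epsilon> / 2\<close> from \<open>D\<close> to the identity.\<close>
  obtain M where M: "M \<ge> 1" "\<And>i. norm (q i ^ M - 1) < \<epsilon> / (2 * CARD('n))"
    using unit_powers_recurrent[of q "\<epsilon> / (2 * CARD('n))"] q(2) eps by auto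
  define D where "D = diag_mat (\<lambda>i. inverse (q i ^ M))"
  have W: "inverse_pair (diag_mat (\<lambda>i. q i ^ M)) D"
    unfolding D_def inverse_pair_def using diag_mat_mult_inverse[of "\<lambda>i. q i ^ M"] qn by simp
  have "norm (D - mat 1) \<le> (\<Sum>i\<in>UNIV. \<Sum>j\<in>UNIV. norm ((D - mat 1) $ i $ j))"
    by (rule norm_matrix_le_sum)
  also have "\<dots> = (\<Sum>i\<in>UNIV. norm (inverse (q i ^ M) - 1))"
  proof (rule sum.cong)
    fix i
    have "(\<Sum>j\<in>UNIV. norm ((D - mat 1) $ i $ j))
        = (\<Sum>j\<in>UNIV. if j = i then norm (inverse (q i ^ M) - 1) else 0)"
      by (rule sum.cong) (auto simp: D_def diag_mat_nth mat_def)
    then show "(\<Sum>j\<in>UNIV. norm ((D - mat 1) $ i $ j)) = norm (inverse (q i ^ M) - 1)" by simp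
  qed simp
  also have "\<dots> < (\<Sum>i::'n\<in>UNIV. \<epsilon> / (2 * CARD('n)))"
  proof (rule sum_strict_mono)
    fix i
    have "inverse (q i ^ M) - 1 = inverse (q i ^ M) * (1 - q i ^ M)"
      using qn[of i] by (simp add: right_diff_distrib)
    then have "norm (inverse (q i ^ M) - 1) = norm (1 - q i ^ M)"
      by (simp only: norm_mult norm_inverse norm_power q(2)) simp
    then show "norm (inverse (q i ^ M) - 1) < \<epsilon> / (2 * CARD('n))"
      using M(2)[of i] by (simp add: norm_minus_commute)
  qed auto
  also have "\<dots> = \<epsilon> / 2" by simp
  finally have D: "norm (D - mat 1) < \<epsilon> / 2" .
  have pw: "diag_mat (\<lambda>i. q i ^ M) ** Y \<in> S" if "real_det Y = 1" "norm (Y - mat 1) < \<epsilon>" for Y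
    unfolding mat_pow_diag_mat[symmetric] using that q(1) eps M(1)
    by (intro mat_pow_mem_near[where P = "\<lambda>X. real_det X = 1 \<and> norm (X - mat 1) < \<epsilon>"])
      (auto intro: mult_S)
  have "real_det (diag_mat (\<lambda>i. q i ^ M)) = 1" using det_S[OF pw[of "mat 1"]] eps by simp
  moreover have "real_det (diag_mat (\<lambda>i. q i ^ M)) * real_det D = 1"
    using W by (simp add: inverse_pair_def flip: real_det_mult)
  ultimately have detD: "real_det D = 1" by simp
  \<comment> \<open>Chosen so that \<open>D ** (X - mat 1)\<close> contributes at most the other
    \<open>\<epsilon> / 2\<close>. Then \<open>D ** X\<close> is near the identity, and
    \<open>X\<close> is recovered by multiplying with the power of
    \<open>diag_mat q\<close>.\<close>
  define \<delta> where "\<delta> = \<epsilon> / (2 * (norm D + 1))"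
  have "norm D + 1 > 0" by (rule add_nonneg_pos) auto
  then have "\<delta> > 0" using eps by (simp add: \<delta>_def)
  moreover have "X \<in> S" if X: "real_det X = 1" "norm (X - mat 1) < \<delta>" for X
  proof -
    have "(D ** (X - mat 1)) $ i $ j = (D ** X) $ i $ j - (D ** mat 1) $ i $ j" for i j
      unfolding matrix_mult_nth by (simp add: right_diff_distrib sum_subtractf)
    then have "D ** (X - mat 1) = D ** X - D" by (simp add: vec_eq_iff)
    then have e: "D ** X - mat 1 = D ** (X - mat 1) + (D - mat 1)" by simp
    have "norm (D ** X - mat 1) \<le> norm D * norm (X - mat 1) + norm (D - mat 1)"
      unfolding e
      using norm_triangle_ineq[of "D ** (X - mat 1)" "D - mat 1"] norm_mat_mult_le[of D "X - mat 1"]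
      by linarith
    also have "norm D * norm (X - mat 1) \<le> (norm D + 1) * \<delta>"
      using X(2) \<open>\<delta> > 0\<close> by (intro mult_mono) auto
    also have "(norm D + 1) * \<delta> = \<epsilon> / 2"
      using \<open>norm D + 1 > 0\<close> by (simp add: \<delta>_def field_simps)
    finally have "norm (D ** X - mat 1) < \<epsilon>" using D by simp
    then have "diag_mat (\<lambda>i. q i ^ M) ** (D ** X) \<in> S"
      by (intro pw) (simp_all add: real_det_mult detD X(1))
    then show "X \<in> S" using W by (simp add: inverse_pair_cancel)
  qed
  ultimately show ?thesis by blast
qed

end

section \<open>Conclusion\<close>

text \<open>The off-diagonal elementary matrix \<open>A\<close> has trace zero and square zero, so
  its exponential series stops at \<open>mat 1 + A\<close>.\<close>

lemma elem_mat_in_SL2_at: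
  fixes r s :: "'n::finite"
  assumes "r \<noteq> s"
  shows "elem_mat s r c \<in> SL2_at r s"
proof -
  define A :: "quat ^ 'n ^ 'n" where "A = (\<chi> i j. if i = s \<and> j = r then c else 0)"
  have "A $ i $ k * A $ k $ j = 0" for i j k using assms by (auto simp: A_def)
  then have "A ** A = 0" by (simp add: vec_eq_iff matrix_mult_nth del: mult_eq_0_iff)
  then have "mat_pow A (Suc (Suc k)) = 0" for k
    by (simp add: matrix_mul_assoc)
  then have "mat_pow A k = 0" if "k \<ge> 2" for k
    using le_Suc_ex[OF that] by (auto simp: numeral_2_eq_2)
  then have "mat_pow A k = 0" if "k \<notin> {0, 1}" for k
    using that by (cases "k \<ge> 2") auto
  then have "(\<lambda>k. mat_pow A k /\<^sub>R fact k) sums (\<Sum>k\<in>{0, 1}. mat_pow A k /\<^sub>R fact k)"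
    by (intro sums_finite) auto
  then have "mat_exp A = mat 1 + A" unfolding mat_exp_def by (simp add: sums_iff)
  also have "\<dots> = elem_mat s r c" by (simp add: vec_eq_iff elem_mat_nth mat_def A_def)
  finally have "mat_exp A = elem_mat s r c" .
  moreover have "A \<in> sl2_at r s"
  proof -
    have "trace A = 0" using assms unfolding trace_def by (intro sum.neutral) (auto simp: A_def)
    then show ?thesis by (auto simp: sl2_at_def sl_def A_def)
  qed
  ultimately show ?thesis unfolding SL2_at_def by (metis generate.incl imageI)
qed

text \<open>From \<open>mat 1 - Z = (Y - mat 1) ** Z\<close> and the bound 1/2,
  \<open>norm Z\<close> is at most twice \<open>norm (mat 1)\<close>. This norm is kept as a factor
  because the Euclidean matrix norm of the identity is not 1 in general.\<close>

lemma inverse_near_one: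
  fixes Y Z :: "quat ^ 'n ^ 'n"
  assumes "Y ** Z = mat 1" "norm (Y - mat 1) \<le> 1 / 2"
  shows "norm (Z - mat 1) \<le> 2 * norm (mat 1 :: quat ^ 'n ^ 'n) * norm (Y - mat 1)"
proof -
  have "((Y - mat 1) ** Z) $ i $ j = (Y ** Z) $ i $ j - (mat 1 ** Z) $ i $ j" for i j
    unfolding matrix_mult_nth by (simp add: left_diff_distrib sum_subtractf)
  then have e: "(Y - mat 1) ** Z = mat 1 - Z" using assms(1) by (simp add: vec_eq_iff)
  have le: "norm (Z - mat 1) \<le> norm (Y - mat 1) * norm Z"
    using norm_mat_mult_le[of "Y - mat 1" Z] by (simp add: e norm_minus_commute)
  also have "\<dots> \<le> 1 / 2 * norm Z" using assms(2) by (intro mult_right_mono) auto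
  finally have "norm Z \<le> 2 * norm (mat 1 :: quat ^ 'n ^ 'n)"
    using norm_triangle_ineq[of "Z - mat 1" "mat 1"] by simp
  then have "norm (Y - mat 1) * norm Z \<le> norm (Y - mat 1) * (2 * norm (mat 1 :: quat ^ 'n ^ 'n))"
    by (intro mult_left_mono) auto
  with le show ?thesis by (simp add: mult_ac)
qed

text \<open>Each eigenvalue is joined to 1 in the punctured quaternions, which are path connected;
  the resulting path of matrices is then normalized into the group.\<close>

lemma diagonal_path_to_one:
  fixes x y :: "quat ^ 'n ^ 'n"
  assumes "inverse_pair x y" "\<And>i. t i \<noteq> 0" "x ** diag_mat t ** y \<in> carrier SL"
  shows "\<exists>C. connected C \<and> C \<subseteq> carrier SL \<and> mat 1 \<in> C \<and> x ** diag_mat t ** y \<in> C"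
proof -
  have "path_connected (- {0 :: quat})"
  proof (rule path_connected_punctured_universe)
    have "card {Quat 1 0 0 0, Quat 0 1 0 0} \<le> DIM(quat)"
      by (rule card_mono) (auto simp: Basis_quat_def)
    then show "2 \<le> DIM(quat)" by simp
  qed
  then have "\<exists>p. path p \<and> path_image p \<subseteq> - {0} \<and> pathstart p = 1 \<and> pathfinish p = t i" for i
    using assms(2)[of i] by (simp add: path_connected_def)
  then obtain p where p: "\<And>i. path (p i)" "\<And>i. path_image (p i) \<subseteq> - {0}" "\<And>i. p i 0 = 1" "\<And>i. p i 1 = t i"
    unfolding pathstart_def pathfinish_def by metis
  define F where "F s = x ** diag_mat (\<lambda>i. p i s) ** y" for s
  have cF: "continuous_on {0..1} F"
    unfolding F_def using p(1) by (intro continuous_intros continuous_on_diag_mat) (simp add: path_def)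
  have F0: "F 0 = mat 1" using assms(1) by (simp add: F_def p(3) diag_mat_one inverse_pair_def)
  have F1: "F 1 = x ** diag_mat t ** y" by (simp add: F_def p(4))
  have cd: "continuous_on {0..1} (\<lambda>s. real_det (F s))"
    by (rule continuous_on_compose2[OF continuous_on_real_det[of UNIV] cF]) simp
  have nz: "real_det (F s) \<noteq> 0" if "s \<in> {0..1}" for s
  proof -
    have "p i s \<noteq> 0" for i using p(2)[of i] that by (auto simp: path_image_def)
    then have "real_det (diag_mat (\<lambda>i. p i s)) \<noteq> 0"
      using real_det_nonzero_if_inverse(1)[OF diag_mat_mult_inverse(1)[of "\<lambda>i. p i s"]] by simp
    then show ?thesis by (simp add: F_def real_det_conj[OF assms(1)])
  qed
  \<comment> \<open>The determinant starts at 1 and never vanishes along the path, so by the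
    intermediate value theorem it stays positive.\<close>
  have pos: "real_det (F s) > 0" if s: "s \<in> {0..1}" for s
  proof (rule ccontr)
    assume "\<not> real_det (F s) > 0"
    moreover have "continuous_on {0..s} (\<lambda>s. real_det (F s))"
      using cd by (rule continuous_on_subset) (use s in auto)
    ultimately obtain z where "0 \<le> z" "z \<le> s" "real_det (F z) = 0"
      using IVT2'[of "\<lambda>s. real_det (F s)" s 0 0] s F0 by auto
    then show False using nz[of z] s by auto
  qed
  have "continuous_on {0..1} (\<lambda>s. sl_normalize (F s))"
    by (rule continuous_on_compose2[OF continuous_on_sl_normalize cF]) (use pos in auto)
  then have "connected ((\<lambda>s. sl_normalize (F s)) ` {0..1})"
    by (rule connected_continuous_image) simp
  moreover have "(\<lambda>s. sl_normalize (F s)) ` {0..1} \<subseteq> carrier SL"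
    using pos by (auto simp: mem_SL_iff real_det_sl_normalize)
  moreover have "sl_normalize (F 0) = mat 1" by (simp add: F0 sl_normalize_SL)
  then have "mat 1 \<in> (\<lambda>s. sl_normalize (F s)) ` {0..1}" by (metis atLeastAtMost_iff image_eqI order_refl zero_le_one)
  moreover have "sl_normalize (F 1) = x ** diag_mat t ** y"
    using assms(3) by (simp add: F1 sl_normalize_SL mem_SL_iff)
  then have "x ** diag_mat t ** y \<in> (\<lambda>s. sl_normalize (F s)) ` {0..1}" by (metis atLeastAtMost_iff image_eqI order_refl zero_le_one)
  ultimately show ?thesis by blast
qed

text \<open>For nearby group elements \<open>g\<close> and \<open>h\<close> both quotients lie near
  the identity, hence in \<open>S\<close>, so membership passes in both directions. Thus
  \<open>S\<close> is open and closed in the group, and connected sets through the identity reach a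
  dense set of points.\<close>

lemma subsemigroup_eq_SL_if_one_interior:
  fixes S :: "(quat ^ 'n ^ 'n) set"
  assumes S: "subsemigroup S SL" and \<delta>: "\<delta> > 0"
    and near: "\<And>X. real_det X = 1 \<Longrightarrow> norm (X - mat 1) < \<delta> \<Longrightarrow> X \<in> S"
  shows "S = carrier SL"
proof (rule ccontr)
  assume ne: "S \<noteq> carrier SL"
  have S_SL: "real_det g = 1" if "g \<in> S" for g
    using S that by (auto simp: subsemigroup_def simp flip: mem_SL_iff)
  have mult: "g ** h \<in> S" if "g \<in> S" "h \<in> S" for g h
    using S that by (simp add: subsemigroup_def SL_def)
  define N where "N = norm (mat 1 :: quat ^ 'n ^ 'n)"
  have inner: "\<exists>e>0. \<forall>h\<in>carrier SL. dist h g < e \<longrightarrow> (h \<in> S \<longleftrightarrow> g \<in> S)" if g: "real_det g = 1" for g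
  proof -
    obtain g' where g': "inverse_pair g g'" using inverse_if_real_det[of g] g by (auto simp: inverse_pair_def)
    have "real_det g * real_det g' = 1" using g' by (simp add: inverse_pair_def flip: real_det_mult)
    then have dg': "real_det g' = 1" using g by simp
    \<comment> \<open>The three bounds serve \<open>inverse_near_one\<close>,
      \<open>Y \<in> S\<close> and \<open>Z \<in> S\<close> in this order.\<close>
    define \<eta> where "\<eta> = min (1 / 2) (min \<delta> (\<delta> / (2 * N + 1)))"
    have N: "N \<ge> 0" "2 * N + 1 > 0" by (auto simp: N_def add_nonneg_pos)
    have \<eta>: "\<eta> > 0" "\<eta> \<le> 1 / 2" "\<eta> \<le> \<delta>" "\<eta> \<le> \<delta> / (2 * N + 1)"
      using \<delta> N unfolding \<eta>_def by (auto simp del: le_divide_eq_numeral1)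
    define e where "e = \<eta> / (norm g' + 1)"
    have gp: "norm g' + 1 > 0" by (rule add_nonneg_pos) auto
    have "e > 0" using \<eta>(1) gp by (simp add: e_def)
    moreover have "h \<in> S \<longleftrightarrow> g \<in> S" if h: "h \<in> carrier SL" "dist h g < e" for h
    proof -
      define Y where "Y = g' ** h"
      obtain h' where h': "inverse_pair h h'" using inverse_if_real_det[of h] h(1) by (auto simp: inverse_pair_def mem_SL_iff)
      have dY: "real_det Y = 1" using h(1) dg' by (simp add: Y_def real_det_mult mem_SL_iff)
      have "(g' ** (h - g)) $ i $ j = (g' ** h) $ i $ j - (g' ** g) $ i $ j" for i j
        unfolding matrix_mult_nth by (simp add: right_diff_distrib sum_subtractf)
      then have eY: "g' ** (h - g) = Y - mat 1" using g' by (simp add: vec_eq_iff Y_def inverse_pair_def)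
      have "norm (Y - mat 1) \<le> norm g' * norm (h - g)"
        using norm_mat_mult_le[of g' "h - g"] by (simp add: eY)
      also have "\<dots> \<le> (norm g' + 1) * norm (h - g)" by (intro mult_right_mono) auto
      also have "\<dots> < (norm g' + 1) * e"
        using h(2) gp by (intro mult_strict_left_mono) (auto simp: dist_norm)
      also have "\<dots> = \<eta>" using gp by (simp add: e_def)
      finally have Y: "norm (Y - mat 1) < \<eta>" .
      define Z where "Z = h' ** g"
      have YZ: "Y ** Z = mat 1"
        using g' h' by (simp add: Y_def Z_def matrix_mul_assoc inverse_pair_cancel) (simp add: inverse_pair_def)
      then have "real_det Y * real_det Z = 1" by (simp flip: real_det_mult)
      then have dZ: "real_det Z = 1" using dY by simp
      have "norm (Z - mat 1) \<le> 2 * N * norm (Y - mat 1)"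
        unfolding N_def using Y \<eta>(2) by (intro inverse_near_one[OF YZ]) auto
      also have "\<dots> \<le> 2 * N * \<eta>" using Y N by (intro mult_left_mono) auto
      also have "\<dots> < (2 * N + 1) * \<eta>" using \<eta>(1) by (simp add: algebra_simps)
      also have "\<dots> \<le> \<delta>" using \<eta>(4) N(2) by (simp add: field_simps)
      finally have Z: "Z \<in> S" using dZ near by blast
      have "Y \<in> S" using near[OF dY] Y \<eta>(3) by simp
      moreover have "h = g ** Y" "g = h ** Z"
        using g' h' by (simp_all add: Y_def Z_def inverse_pair_cancel)
      ultimately show ?thesis using mult Z by metis
    qed
    ultimately show ?thesis by blast
  qed
  obtain g where g: "g \<in> carrier SL" "g \<notin> S" using ne S by (auto simp: subsemigroup_def)
  obtain e where e: "e > 0" "\<forall>h\<in>carrier SL. dist h g < e \<longrightarrow> (h \<in> S \<longleftrightarrow> g \<in> S)"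
    using inner[OF g(1)[unfolded mem_SL_iff]] by blast
  \<comment> \<open>A whole neighbourhood of \<open>g\<close> in the group misses \<open>S\<close>,
    so density provides a diagonalizable point outside \<open>S\<close>.\<close>
  from e(1) obtain x y t where xyt: "inverse_pair x y" "x ** diag_mat t ** y \<in> ball g e" "x ** diag_mat t ** y \<in> carrier SL"
    "\<forall>j. t j \<noteq> 0"
    using diagonalizable_dense_SL[of "ball g e" g] g(1) by auto
  then have notS: "x ** diag_mat t ** y \<notin> S" using e(2) g(2) by (auto simp: dist_commute)
  obtain C where C: "connected C" "C \<subseteq> carrier SL" "mat 1 \<in> C" "x ** diag_mat t ** y \<in> C"
    using diagonal_path_to_one[OF xyt(1) _ xyt(3)] xyt(4) by blast
  have inner': "\<exists>e>0. \<forall>h\<in>C. dist h g < e \<longrightarrow> (h \<in> S \<longleftrightarrow> g \<in> S)" if "g \<in> C" for g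
  proof -
    have "real_det g = 1" using that C(2) by (auto simp flip: mem_SL_iff)
    from inner[OF this] show ?thesis using C(2) by (meson subsetD)
  qed
  have op: "openin (top_of_set C) {h \<in> C. h \<in> S \<longleftrightarrow> b}" for b
    unfolding openin_euclidean_subtopology_iff
  proof (intro conjI ballI)
    fix g assume g: "g \<in> {h \<in> C. h \<in> S \<longleftrightarrow> b}"
    then have "g \<in> C" by simp
    from inner'[OF this] obtain e
      where "e > 0" "\<forall>h\<in>C. dist h g < e \<longrightarrow> (h \<in> S \<longleftrightarrow> g \<in> S)"
      by (elim exE conjE)
    with g show "\<exists>e>0. \<forall>h\<in>C. dist h g < e \<longrightarrow> h \<in> {h \<in> C. h \<in> S \<longleftrightarrow> b}"
      by (intro exI[of _ e]) auto
  qed auto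
  have "{h \<in> C. h \<in> S \<longleftrightarrow> True} = C \<inter> S" "{h \<in> C. h \<in> S \<longleftrightarrow> False} = C - C \<inter> S" by auto
  with op[of True] op[of False] have "openin (top_of_set C) (C \<inter> S)" "openin (top_of_set C) (C - C \<inter> S)"
    by simp_all
  then have "closedin (top_of_set C) (C \<inter> S)" by (simp add: closedin_def)
  with C(1) \<open>openin (top_of_set C) (C \<inter> S)\<close> have "C \<inter> S = {} \<or> C \<inter> S = C"
    unfolding connected_clopen by blast
  moreover have "mat 1 \<in> S" using near[of "mat 1"] \<delta> by simp
  ultimately show False using C(3,4) notS by blast
qed

theorem theorem3p1:
  fixes S :: "(quat ^ 'n::{finite,linorder} ^ 'n::{finite,linorder}) set"
    and r s :: "'n::{finite,linorder}"
  assumes "subsemigroup S SL"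
    and "top_of_set (carrier SL) interior_of S \<noteq> {}"
    and "r < s"
    and "SL2_at r s \<subseteq> S"
  shows "S = carrier SL"
proof -
  have r_ne_s: "r \<noteq> s" using assms(3) by simp
  have S_SL: "real_det g = 1" if "g \<in> S" for g
    using assms(1) that by (auto simp: subsemigroup_def simp flip: mem_SL_iff)
  have mult: "g ** h \<in> S" if "g \<in> S" "h \<in> S" for g h
    using assms(1) that by (simp add: subsemigroup_def SL_def)
  obtain W g where W: "open W" "g \<in> carrier SL" "g \<in> W" "carrier SL \<inter> W \<subseteq> S"
    using assms(2) by (auto simp: interior_of_def openin_open)
  obtain x0 y0 t where 0: "inverse_pair x0 y0" "x0 ** diag_mat t ** y0 \<in> W" "x0 ** diag_mat t ** y0 \<in> carrier SL"
    "inj (\<lambda>j. norm (t j))" "\<forall>j. t j \<noteq> 0"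
    using diagonalizable_dense_SL[OF W(1,3,2)] by blast
  have dett: "real_det (diag_mat t) = 1" using 0(3) by (simp add: mem_SL_iff real_det_conj[OF 0(1)])
  \<comment> \<open>Only the eigenbasis is perturbed from here on; the eigenvalues \<open>t\<close>,
    and with them the determinant, stay fixed.\<close>
  define V where "V = (\<lambda>p. fst p ** diag_mat t ** snd p) -` W"
  have "open V"
    unfolding V_def by (intro open_vimage W(1) continuous_intros)
  then obtain x y where xy: "(x, y) \<in> V" "inverse_pair x y"
    "\<forall>J\<in>UNIV - {{}, UNIV}. (\<Sum>i\<in>J. x $ r $ i * y $ i $ s) \<noteq> 0"
    using perturb_partial_sums[of "UNIV - {{}, UNIV}" V x0 y0 r s] 0(1,2) by (auto simp: V_def)
  \<comment> \<open>The semigroup \<open>S\<close> in the coordinates of the eigenbasis.\<close>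
  define T where "T = {g. x ** g ** y \<in> S}"
  define F where "F X = (x ** (diag_mat t ** X) ** y, x ** (X ** diag_mat t) ** y)" for X
  have "continuous_on UNIV F" unfolding F_def by (intro continuous_intros)
  then have "open (F -` (W \<times> W))" using W(1) by (simp add: continuous_on_open_vimage open_Times)
  moreover have "mat 1 \<in> F -` (W \<times> W)" using xy(1) by (simp add: F_def V_def)
  ultimately obtain \<epsilon> where \<epsilon>: "\<epsilon> > 0" "ball (mat 1) \<epsilon> \<subseteq> F -` (W \<times> W)"
    by (metis openE)
  interpret semigroup_in_eigenbasis T t "\<lambda>i. y $ i $ s" "\<lambda>i. x $ r $ i" \<epsilon>
  proof
    show "real_det g = 1" if "g \<in> T" for g
      using that S_SL real_det_conj[OF xy(2)] unfolding T_def by (metis mem_Collect_eq)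
    show "g ** h \<in> T" if "g \<in> T" "h \<in> T" for g h
    proof -
      have "x ** g ** y ** (x ** h ** y) = x ** (g ** (y ** (x ** (h ** y))))"
        by (simp add: matrix_mul_assoc)
      then have "x ** g ** y ** (x ** h ** y) = x ** (g ** h) ** y"
        by (simp only: inverse_pair_cancel[OF xy(2)]) (simp add: matrix_mul_assoc)
      then show ?thesis using mult[of "x ** g ** y" "x ** h ** y"] that by (simp add: T_def)
    qed
    show "diag_mat t ** X \<in> T \<and> X ** diag_mat t \<in> T" if "real_det X = 1" "norm (X - mat 1) < \<epsilon>" for X
    proof -
      have "X \<in> ball (mat 1) \<epsilon>" using that(2) by (simp add: dist_norm norm_minus_commute)
      then have "F X \<in> W \<times> W" using \<epsilon>(2) by blast
      moreover have "x ** (diag_mat t ** X) ** y \<in> carrier SL" "x ** (X ** diag_mat t) ** y \<in> carrier SL"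
        using that(1) dett by (simp_all only: mem_SL_iff real_det_conj[OF xy(2)] real_det_mult[of "diag_mat t"]
            real_det_mult[of X] mult_1)
      ultimately show ?thesis using W(4) by (auto simp: T_def F_def)
    qed
    show "mat 1 + (\<chi> i j. y $ i $ s * c * x $ r $ j) \<in> T" for c
    proof -
      \<comment> \<open>In the new basis the root element differs from the identity by column
        \<open>s\<close> of \<open>y\<close> times \<open>c\<close> times row \<open>r\<close> of
        \<open>x\<close>.\<close>
      have "(y ** elem_mat s r c ** x) $ i $ j = (mat 1 + (\<chi> i j. y $ i $ s * c * x $ r $ j)) $ i $ j" for i j
      proof -
        have "(y ** elem_mat s r c ** x) $ i $ j
            = (\<Sum>k\<in>UNIV. y $ i $ k * x $ k $ j + (if k = r then y $ i $ s * c * x $ r $ j else 0))"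
          unfolding matrix_mult_nth[of "y ** elem_mat s r c"]
          by (rule sum.cong) (auto simp: mult_elem_mat_nth distrib_right)
        also have "\<dots> = (y ** x) $ i $ j + y $ i $ s * c * x $ r $ j"
          by (simp add: sum.distrib matrix_mult_nth)
        finally show ?thesis using xy(2) by (simp add: inverse_pair_def)
      qed
      then have e: "mat 1 + (\<chi> i j. y $ i $ s * c * x $ r $ j) = y ** elem_mat s r c ** x"
        by (simp add: vec_eq_iff)
      have "x ** (y ** elem_mat s r c ** x) ** y = x ** (y ** (elem_mat s r c ** x)) ** y"
        by (simp add: matrix_mul_assoc)
      then have "x ** (y ** elem_mat s r c ** x) ** y = elem_mat s r c" using xy(2) by (simp only: inverse_pair_cancel)
      then show ?thesis using elem_mat_in_SL2_at[OF r_ne_s, of c] assms(4) by (auto simp: T_def e)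
    qed
    show "(\<Sum>i\<in>J. x $ r $ i * y $ i $ s) \<noteq> 0" if "J \<noteq> {}" "J \<noteq> UNIV" for J
      using xy(3) that by blast
    \<comment> \<open>The full sum is an off-diagonal entry of
      \<open>x ** y = mat 1\<close>.\<close>
    have "(\<Sum>i\<in>UNIV. x $ r $ i * y $ i $ s) = (x ** y) $ r $ s" by (simp add: matrix_mult_nth)
    then show "(\<Sum>i\<in>UNIV. x $ r $ i * y $ i $ s) = 0" using xy(2) r_ne_s by (simp add: inverse_pair_def mat_def)
  qed (use \<epsilon>(1) 0(4,5) in auto)
  obtain \<delta> where \<delta>: "\<delta> > 0" "\<And>X. real_det X = 1 \<Longrightarrow> norm (X - mat 1) < \<delta> \<Longrightarrow> X \<in> T"
    using one_interior by blast
  \<comment> \<open>Conjugation is continuous and fixes the identity, which carries its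
    neighbourhood in \<open>T\<close> back to one in \<open>S\<close>.\<close>
  have "continuous_on UNIV (\<lambda>X. y ** X ** x)" by (intro continuous_intros)
  then have "open ((\<lambda>X. y ** X ** x) -` ball (mat 1) \<delta>)" by (simp add: continuous_on_open_vimage)
  moreover have "mat 1 \<in> (\<lambda>X. y ** X ** x) -` ball (mat 1) \<delta>"
    using xy(2) \<delta>(1) by (simp add: inverse_pair_def)
  ultimately obtain \<eta> where \<eta>: "\<eta> > 0" "ball (mat 1) \<eta> \<subseteq> (\<lambda>X. y ** X ** x) -` ball (mat 1) \<delta>"
    by (metis openE)
  show ?thesis
  proof (rule subsemigroup_eq_SL_if_one_interior[OF assms(1) \<eta>(1)])
    fix X :: "quat ^ 'n::{finite,linorder} ^ 'n::{finite,linorder}"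
    assume X: "real_det X = 1" "norm (X - mat 1) < \<eta>"
    then have "X \<in> ball (mat 1) \<eta>" by (simp add: dist_norm norm_minus_commute)
    then have "y ** X ** x \<in> ball (mat 1) \<delta>" using \<eta>(2) by blast
    then have "y ** X ** x \<in> T"
      using X(1) by (intro \<delta>(2)) (simp_all add: real_det_conj[OF inverse_pair_sym[OF xy(2)]] dist_norm norm_minus_commute)
    moreover have "x ** (y ** X ** x) ** y = x ** (y ** (X ** x)) ** y"
      by (simp add: matrix_mul_assoc)
    then have "x ** (y ** X ** x) ** y = X" using xy(2) by (simp only: inverse_pair_cancel)
    ultimately show "X \<in> S" by (simp add: T_def)
  qed
qed

end
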